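(* Let $N$, $\sigma$, $\alpha=\sigma\cdot\sigma$, $\langle\cdot|\cdot\rangle$, $g$, $\nabla^\circ$, $\xi$, $(M,h)$ and the $C^2$ map $\psi:N\to M$ be as described in the context, and let $x_0\in N$. Assume that there exist $\delta_1>0$ and $\gamma_1>0$ such that there is a unique $C^2$ mapping $(\gamma,t,x)\mapsto u^\gamma(t,x)$ from $[0,\gamma_1]\times[0,\delta_1]\times N$ to $M$ satisfying, for each $\gamma\in[0,\gamma_1]$, $$\frac{\partial u^\gamma}{\partial t}=du^\gamma\cdot\xi+\frac{\gamma}{2}\nabla du^\gamma(\sigma\cdot\sigma),\qquad u^\gamma(0,\cdot)=\psi .$$ Let $0\le\delta\le\delta_1$. Let $\{\phi_t,t\ge 0\}$ be the flow of the vector field $\xi$, let $x_t:=\phi_t(x_0)$, and let $$\Pi_t:=\int_0^t(\phi_{-s})_*\langle\cdot|\cdot\rangle_{x_s}\,ds\in T_{x_0}N\otimes T_{x_0}N .$$ Then, in the tangent space $T_{\psi(x_\delta)}M$, $$\left.\frac{\partial}{\partial\gamma}u^\gamma(\delta,x_0)\right|_{\gamma=0}=\frac12\Big\{\nabla d\psi(x_\delta)\big((\phi_\delta)_*\Pi_\delta\big)+\psi_*\Big\{\nabla^\circ d\phi_\delta(x_0)(\Pi_\delta)-\int_0^\delta(\phi_{\delta-t})_*\,\nabla^\circ d\phi_t(x_0)\,d\Pi_t\Big\}\Big\}.$$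
   Context: **Diffusion and metric.** $N$ is a connected manifold of dimension $p$. A Markov diffusion process $X$ on $N$ is given in coordinates by $dX^i_t=b^i(X_t)\,dt+\sum_{j=1}^p\sigma^i_j(X_t)\,dW^j_t$, where $W$ is a Wiener process in $\mathbb{R}^p$, $\sigma(x)=(\sigma^i_j(x))\in L(\mathbb{R}^p;T_xN)$, and $b^i,\sigma^i_j$ are $C^2$ with bounded first derivative. The diffusion variance semi-definite metric on $T^*N$ is $\langle dx^i|dx^k\rangle_x=\alpha^{ik}(x)=(\sigma\cdot\sigma)^{ik}(x):=\sum_j\sigma^i_j(x)\sigma^k_j(x)$; it may be degenerate. It is also regarded as the symmetric tensor $\langle\cdot|\cdot\rangle_x=(\sigma\cdot\sigma)(x)=\sum_{i,k}\alpha^{ik}(x)\,\partial_i\otimes\partial_k\in T_xN\otimes T_xN$, and as the linear map $\alpha(x):T^*_xN\to T_xN$, $\alpha(x)(dx^i)=\sum_j\alpha^{ij}\partial/\partial x_j$. Constant rank is assumed: there is a rank $r$ sub-bundle $E\subseteq TN$ with $E_x=\operatorname{range}\sigma(x)$ for all $x\in N$. **Generalized inverse and connection $\nabla^\circ$.** $g:TN\to T^*N$ is a chosen vector bundle isomorphism, expressed in local coordinates by a Riemannian metric tensor $(g_{rs})$, with $\alpha(x)\circ g(x)\circ\alpha(x)=\alpha(x)$, i.e. $\sum_{r,s}\alpha^{ir}g_{rs}\alpha^{sj}=\alpha^{ij}$. The canonical sub-Riemannian connection $\nabla^\circ$ on $TN$ for $\langle\cdot|\cdot\rangle$ with respect to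 $g$ has Christoffel symbols $\Gamma^s_{ij}$ given in local coordinates by $$\sum_s\Gamma^s_{ij}g_{sk}=\tfrac12\sum_{r,s}\Big\{\tfrac{\partial}{\partial x_i}(g_{jr}\alpha^{rs}g_{sk})+\tfrac{\partial}{\partial x_j}(g_{ir}\alpha^{rs}g_{sk})-\tfrac{\partial}{\partial x_k}(g_{ir}\alpha^{rs}g_{sj})\Big\}.$$ The local connector is $\Gamma(x)(u\otimes v)=\sum_{i,j,k}\Gamma^k_{ij}(x)u^iv^j\,\partial_k$. **Vector field $\xi$.** $\xi=\sum_k\{b^k+\tfrac12\sum_{i,j}\alpha^{ij}\Gamma^k_{ij}\}D_k$. Thus $X$ has generator $\xi+\tfrac12\Delta$ with $\Delta=\sum_{i,j}\alpha^{ij}\{D_{ij}-\sum_k\Gamma^k_{ij}D_k\}$. It is assumed that $\xi$ and $\langle\cdot|\cdot\rangle$ are sufficiently differentiable for the derivatives appearing in the statement to exist. **Target and second fundamental forms.** $(M,h)$ is a Riemannian manifold with Levi-Civita connection, whose local connector is $\bar\Gamma$. For a $C^2$ map $\phi:N\to M$, the second fundamental form $\nabla d\phi(x)\in L(T_xN\otimes T_xN;T_{\phi(x)}M)$ is, in local coordinates, $$\nabla d\phi(x)(v\otimes w)=D^2\phi(x)(v\otimes w)-D\phi(x)\Gamma(x)(v\otimes w)+\bar\Gamma(\phi(x))(D\phi(x)v\otimes D\phi(x)w).$$ For maps $\phi:N\to N$, $\nabla^\circ d\phi$ is given by the same formula with $\Gamma$ in place of $\bar\Gamma$. **Push-forward.**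 $\phi_*\zeta$ denotes $d\phi\cdot\zeta$, and $\phi_*(\zeta\otimes\zeta')=\phi_*\zeta\otimes\phi_*\zeta'$. In the last integral the integrand means $d\phi_{\delta-t}(x_t)\big[\nabla^\circ d\phi_t(x_0)\big(\tfrac{d\Pi_t}{dt}\big)\big]dt$, and $\psi_*$ means application of $d\psi(x_\delta)$.
   Formalization: For degenerate α the displayed Christoffel formula depends on the coordinates, so ∇° and ξ are not well defined in general; the formal theorem fixes an atlas and assumes that the formula in its charts defines a connection (automatic for nondegenerate α or one global chart). *)

theory Defs
  imports "HOL-Analysis.Analysis"
begin

section \<open>Differentiability of finite order\<close>

text \<open>
  Derivatives are taken within the set, so that the definition also covers sets with boundary such
  as \<open>[0,a] \<times> [0,b] \<times> U\<close> with \<open>U\<close> open (one-sided derivatives on the boundary). It is only used for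
  open sets and for relatively open subsets of such products, where derivatives are unique.
\<close>

primrec Ck_on :: "nat \<Rightarrow> ('a::real_normed_vector \<Rightarrow> 'b::real_normed_vector) \<Rightarrow> 'a set \<Rightarrow> bool" where
  "Ck_on 0 f S \<longleftrightarrow> continuous_on S f"
| "Ck_on (Suc k) f S \<longleftrightarrow> (\<forall>x\<in>S. f differentiable (at x within S)) \<and>
     (\<forall>v. Ck_on k (\<lambda>x. frechet_derivative f (at x within S) v) S)"

definition D1 :: "('a::real_normed_vector \<Rightarrow> 'b::real_normed_vector) \<Rightarrow> 'a \<Rightarrow> 'a \<Rightarrow> 'b" where
  "D1 f y v = frechet_derivative f (at y) v"

definition D2 :: "('a::real_normed_vector \<Rightarrow> 'b::real_normed_vector) \<Rightarrow> 'a \<Rightarrow> 'a \<Rightarrow> 'a \<Rightarrow> 'b" where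
  "D2 f y v w = D1 (\<lambda>z. D1 f z v) y w"

text \<open>
  An element \<open>\<Sum>\<^sub>i\<^sub>j T\<^sup>i\<^sup>j e\<^sub>i \<otimes> e\<^sub>j\<close> of \<open>\<real>\<^sup>p \<otimes> \<real>\<^sup>p\<close> is the matrix \<open>T\<close>;
  \<open>on_tensor B\<close> is the linear map on the tensor product induced by the bilinear map \<open>B\<close>.
\<close>

definition on_tensor :: "(real^'p \<Rightarrow> real^'p \<Rightarrow> 'b::real_vector) \<Rightarrow> real^'p^'p \<Rightarrow> 'b" where
  "on_tensor B T = (\<Sum>i\<in>UNIV. \<Sum>j\<in>UNIV. (T $ i $ j) *\<^sub>R B (axis i 1) (axis j 1))"


section \<open>Manifolds\<close>

text \<open>
  A manifold is a Hausdorff second countable type with a smooth atlas, which need not be maximal.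
  ``In local coordinates'' means in every chart of the given atlas.
\<close>

type_synonym ('n, 'p) chart = "'n set \<times> ('n \<Rightarrow> real^'p)"

abbreviation cdom :: "('n, 'p) chart \<Rightarrow> 'n set" where "cdom c \<equiv> fst c"
abbreviation cmap :: "('n, 'p) chart \<Rightarrow> 'n \<Rightarrow> real^'p" where "cmap c \<equiv> snd c"
abbreviation cimg :: "('n, 'p) chart \<Rightarrow> (real^'p) set" where "cimg c \<equiv> cmap c ` cdom c"
abbreviation cinv :: "('n, 'p) chart \<Rightarrow> real^'p \<Rightarrow> 'n" where "cinv c \<equiv> inv_into (cdom c) (cmap c)"

definition smooth_atlas ::
    "('n::{t2_space,second_countable_topology}, 'p::finite) chart set \<Rightarrow> bool" where
  "smooth_atlas A \<longleftrightarrow>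
     (\<Union>c\<in>A. cdom c) = UNIV \<and>
     (\<forall>c\<in>A. open (cdom c) \<and> open (cimg c) \<and> homeomorphism (cdom c) (cimg c) (cmap c) (cinv c)) \<and>
     (\<forall>c\<in>A. \<forall>c'\<in>A. \<forall>k. Ck_on k (cmap c' \<circ> cinv c) (cmap c ` (cdom c \<inter> cdom c')))"

definition Ck_map :: "nat \<Rightarrow> ('n::topological_space, 'p::finite) chart set \<Rightarrow>
    ('m::topological_space, 'q::finite) chart set \<Rightarrow> ('n \<Rightarrow> 'm) \<Rightarrow> bool" where
  "Ck_map k A B f \<longleftrightarrow> continuous_on UNIV f \<and>
     (\<forall>c\<in>A. \<forall>c'\<in>B. Ck_on k (cmap c' \<circ> f \<circ> cinv c) {y \<in> cimg c. f (cinv c y) \<in> cdom c'})"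

text \<open>Joint differentiability of \<open>(s, x) \<mapsto> F s x\<close> on \<open>S \<times> N\<close>.\<close>

definition Ck_family :: "nat \<Rightarrow> 's::real_normed_vector set \<Rightarrow>
    ('n::topological_space, 'p::finite) chart set \<Rightarrow>
    ('m::topological_space, 'q::finite) chart set \<Rightarrow> ('s \<Rightarrow> 'n \<Rightarrow> 'm) \<Rightarrow> bool" where
  "Ck_family k S A B F \<longleftrightarrow> continuous_on (S \<times> UNIV) (\<lambda>(s, x). F s x) \<and>
     (\<forall>c\<in>A. \<forall>c'\<in>B. Ck_on k (\<lambda>(s, y). cmap c' (F s (cinv c y)))
        {(s, y). s \<in> S \<and> y \<in> cimg c \<and> F s (cinv c y) \<in> cdom c'})"


section \<open>Tangent vectors, tensors and differentials\<close>

text \<open>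
  A tangent vector at \<open>x\<close> is the family of its components in the charts at \<open>x\<close>, and likewise for
  elements of \<open>T\<^sub>xN \<otimes> T\<^sub>xN\<close>. Values at charts not containing \<open>x\<close> are irrelevant, so two tangent
  vectors at \<open>x\<close> are equal iff they agree on all charts at \<open>x\<close>.
  Fields are given by their components \<open>V c x\<close> in a chart \<open>c\<close> at a point \<open>x \<in> cdom c\<close>.
\<close>

type_synonym ('n, 'p) tvec = "('n, 'p) chart \<Rightarrow> real^'p"
type_synonym ('n, 'p) tens2 = "('n, 'p) chart \<Rightarrow> real^'p^'p"
type_synonym ('n, 'p) vfield = "('n, 'p) chart \<Rightarrow> 'n \<Rightarrow> real^'p"
type_synonym ('n, 'p) mfield = "('n, 'p) chart \<Rightarrow> 'n \<Rightarrow> real^'p^'p"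
type_synonym ('n, 'p) symbols = "('n, 'p) chart \<Rightarrow> 'n \<Rightarrow> 'p \<Rightarrow> 'p \<Rightarrow> 'p \<Rightarrow> real"

definition Ck_field :: "nat \<Rightarrow> ('n, 'p::finite) chart set \<Rightarrow>
    (('n, 'p) chart \<Rightarrow> 'n \<Rightarrow> 'b::real_normed_vector) \<Rightarrow> bool" where
  "Ck_field k A V \<longleftrightarrow> (\<forall>c\<in>A. Ck_on k (\<lambda>y. V c (cinv c y)) (cimg c))"

definition bounded_first_derivative :: "('n, 'p::finite) chart set \<Rightarrow>
    (('n, 'p) chart \<Rightarrow> 'n \<Rightarrow> 'b::real_normed_vector) \<Rightarrow> bool" where
  "bounded_first_derivative A V \<longleftrightarrow>
     (\<forall>c\<in>A. \<exists>K. \<forall>y\<in>cimg c. \<forall>v. norm (D1 (\<lambda>z. V c (cinv c z)) y v) \<le> K * norm v)"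

definition partial_deriv :: "('n, 'p::finite) chart \<Rightarrow> 'p \<Rightarrow> ('n \<Rightarrow> real) \<Rightarrow> 'n \<Rightarrow> real" where
  "partial_deriv c i f x = D1 (f \<circ> cinv c) (cmap c x) (axis i 1)"

definition transition_D1 ::
    "('n, 'p::finite) chart \<Rightarrow> ('n, 'p) chart \<Rightarrow> 'n \<Rightarrow> real^'p \<Rightarrow> real^'p" where
  "transition_D1 c c' x = D1 (cmap c' \<circ> cinv c) (cmap c x)"

definition transition_D2 ::
    "('n, 'p::finite) chart \<Rightarrow> ('n, 'p) chart \<Rightarrow> 'n \<Rightarrow> real^'p \<Rightarrow> real^'p \<Rightarrow> real^'p" where
  "transition_D2 c c' x = D2 (cmap c' \<circ> cinv c) (cmap c x)"

text \<open>
  The definitions below evaluate coordinate expressions in some chart at the source point; for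
  families obeying the usual transformation laws the result does not depend on the choice.
\<close>

definition chart_at :: "('n, 'p) chart set \<Rightarrow> 'n \<Rightarrow> ('n, 'p) chart" where
  "chart_at A x = (SOME c. c \<in> A \<and> x \<in> cdom c)"

definition local_rep :: "('n, 'p) chart \<Rightarrow> ('m, 'q) chart \<Rightarrow> ('n \<Rightarrow> 'm) \<Rightarrow> real^'p \<Rightarrow> real^'q" where
  "local_rep c c' f = cmap c' \<circ> f \<circ> cinv c"

text \<open>The push-forward \<open>df(x) v\<close>, and its extension to \<open>T\<^sub>xN \<otimes> T\<^sub>xN\<close>.\<close>

definition push :: "('n, 'p::finite) chart set \<Rightarrow> ('n \<Rightarrow> 'm) \<Rightarrow> 'n \<Rightarrow> ('n, 'p) tvec \<Rightarrow>
    ('m, 'q::finite) tvec" where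
  "push A f x v = (\<lambda>c'. let c = chart_at A x in D1 (local_rep c c' f) (cmap c x) (v c))"

definition push2 :: "('n, 'p::finite) chart set \<Rightarrow> ('n \<Rightarrow> 'm) \<Rightarrow> 'n \<Rightarrow> ('n, 'p) tens2 \<Rightarrow>
    ('m, 'q::finite) tens2" where
  "push2 A f x T = (\<lambda>c'. let c = chart_at A x; L = matrix (D1 (local_rep c c' f) (cmap c x))
     in L ** T c ** transpose L)"


section \<open>Connections and second fundamental forms\<close>

text \<open>\<open>\<Gamma> c x k i j\<close> is the Christoffel symbol \<open>\<Gamma>\<^sup>k\<^sub>i\<^sub>j\<close>.\<close>

definition connector ::
    "('n, 'p::finite) symbols \<Rightarrow> ('n, 'p) chart \<Rightarrow> 'n \<Rightarrow> real^'p \<Rightarrow> real^'p \<Rightarrow> real^'p" where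
  "connector \<Gamma> c x u v = (\<chi> k. \<Sum>i\<in>UNIV. \<Sum>j\<in>UNIV. \<Gamma> c x k i j * u $ i * v $ j)"

text \<open>The law by which the Christoffel symbols of a linear connection on the tangent bundle change.\<close>

definition is_connection :: "('n, 'p::finite) chart set \<Rightarrow> ('n, 'p) symbols \<Rightarrow> bool" where
  "is_connection A \<Gamma> \<longleftrightarrow> (\<forall>c\<in>A. \<forall>c'\<in>A. \<forall>x\<in>cdom c \<inter> cdom c'. \<forall>v w.
     connector \<Gamma> c' x (transition_D1 c c' x v) (transition_D1 c c' x w) =
     transition_D1 c c' x (connector \<Gamma> c x v w) - transition_D2 c c' x v w)"

text \<open>\<open>\<nabla>df(x)(T)\<close>, for connections \<open>\<Gamma>\<close> on the source and \<open>\<Gamma>'\<close> on the target of \<open>f\<close>.\<close>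

definition second_fund_form :: "('n, 'p::finite) chart set \<Rightarrow> ('n, 'p) symbols \<Rightarrow>
    ('m, 'q::finite) symbols \<Rightarrow> ('n \<Rightarrow> 'm) \<Rightarrow> 'n \<Rightarrow> ('n, 'p) tens2 \<Rightarrow> ('m, 'q) tvec" where
  "second_fund_form A \<Gamma> \<Gamma>' f x T = (\<lambda>c'.
     let c = chart_at A x; F = local_rep c c' f; y = cmap c x in
     on_tensor (\<lambda>v w. D2 F y v w - D1 F y (connector \<Gamma> c x v w)
                      + connector \<Gamma>' c' (f x) (D1 F y v) (D1 F y w)) (T c))"

text \<open>Only the regularity needed for Christoffel symbols is demanded; smooth metrics are a special case.\<close>

definition riemannian_metric :: "('n, 'p::finite) chart set \<Rightarrow> ('n, 'p) mfield \<Rightarrow> bool" where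
  "riemannian_metric A g \<longleftrightarrow> Ck_field 1 A g \<and>
     (\<forall>c\<in>A. \<forall>x\<in>cdom c. transpose (g c x) = g c x \<and> (\<forall>v. v \<noteq> 0 \<longrightarrow> v \<bullet> (g c x *v v) > 0)) \<and>
     (\<forall>c\<in>A. \<forall>c'\<in>A. \<forall>x\<in>cdom c \<inter> cdom c'. \<forall>v w.
        transition_D1 c c' x v \<bullet> (g c' x *v transition_D1 c c' x w) = v \<bullet> (g c x *v w))"

text \<open>The Levi-Civita connection: torsion-free and compatible with the metric.\<close>

definition levi_civita ::
    "('n, 'p::finite) chart set \<Rightarrow> ('n, 'p) mfield \<Rightarrow> ('n, 'p) symbols \<Rightarrow> bool" where
  "levi_civita A h \<Gamma> \<longleftrightarrow> is_connection A \<Gamma> \<and>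
     (\<forall>c\<in>A. \<forall>x\<in>cdom c. \<forall>i j k.
        \<Gamma> c x k i j = \<Gamma> c x k j i \<and>
        partial_deriv c k (\<lambda>z. h c z $ i $ j) x =
          (\<Sum>l\<in>UNIV. \<Gamma> c x l k i * h c x $ l $ j + \<Gamma> c x l k j * h c x $ i $ l))"


section \<open>The diffusion and its sub-Riemannian structure\<close>

definition diffusion_variance :: "('n, 'p::finite) mfield \<Rightarrow> ('n, 'p) mfield" where
  "diffusion_variance \<sigma> c x = \<sigma> c x ** transpose (\<sigma> c x)"

text \<open>
  Coefficients of \<open>dX = b(X) dt + \<sigma>(X) dW\<close> in the charts of \<open>A\<close>, where \<open>W\<close> lives in \<open>\<real>\<^sup>p\<close>: the
  columns of \<open>\<sigma>\<close> are vector fields, while \<open>b\<close> changes by Ito's formula; \<open>\<sigma>\<close> has constant rank \<open>r\<close>.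
\<close>

definition diffusion :: "('n, 'p::finite) chart set \<Rightarrow> ('n, 'p) vfield \<Rightarrow> ('n, 'p) mfield \<Rightarrow>
    nat \<Rightarrow> bool" where
  "diffusion A b \<sigma> r \<longleftrightarrow>
     Ck_field 2 A b \<and> Ck_field 2 A \<sigma> \<and>
     bounded_first_derivative A b \<and> bounded_first_derivative A \<sigma> \<and>
     (\<forall>c\<in>A. \<forall>c'\<in>A. \<forall>x\<in>cdom c \<inter> cdom c'.
        (\<forall>w. \<sigma> c' x *v w = transition_D1 c c' x (\<sigma> c x *v w)) \<and>
        b c' x = transition_D1 c c' x (b c x)
                 + (1/2) *\<^sub>R on_tensor (transition_D2 c c' x) (diffusion_variance \<sigma> c x)) \<and>
     (\<forall>c\<in>A. \<forall>x\<in>cdom c. rank (\<sigma> c x) = r)"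

definition generalized_inverse ::
    "('n, 'p::finite) chart set \<Rightarrow> ('n, 'p) mfield \<Rightarrow> ('n, 'p) mfield \<Rightarrow> bool" where
  "generalized_inverse A \<alpha> g \<longleftrightarrow> riemannian_metric A g \<and>
     (\<forall>c\<in>A. \<forall>x\<in>cdom c. \<alpha> c x ** g c x ** \<alpha> c x = \<alpha> c x)"

text \<open>
  The connection on the tangent bundle whose Christoffel symbols are given by the formula. That it is
  a connection is part of the definition: it follows from the formula when \<open>\<alpha>\<close> is nondegenerate and
  is trivial for a one-chart atlas, but for degenerate \<open>\<alpha>\<close> the formula itself is not invariant under
  arbitrary changes of coordinates (the inhomogeneous term is composed with \<open>\<alpha> \<circ> g\<close>).
\<close>

definition sub_riemannian_connection :: "('n, 'p::finite) chart set \<Rightarrow> ('n, 'p) mfield \<Rightarrow>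
    ('n, 'p) mfield \<Rightarrow> ('n, 'p) symbols \<Rightarrow> bool" where
  "sub_riemannian_connection A \<alpha> g \<Gamma> \<longleftrightarrow> is_connection A \<Gamma> \<and>
     (\<forall>c\<in>A. \<forall>x\<in>cdom c. \<forall>i j k.
        (\<Sum>s\<in>UNIV. \<Gamma> c x s i j * g c x $ s $ k) =
        (1/2) * (\<Sum>r\<in>UNIV. \<Sum>s\<in>UNIV.
            partial_deriv c i (\<lambda>z. g c z $ j $ r * \<alpha> c z $ r $ s * g c z $ s $ k) x
          + partial_deriv c j (\<lambda>z. g c z $ i $ r * \<alpha> c z $ r $ s * g c z $ s $ k) x
          - partial_deriv c k (\<lambda>z. g c z $ i $ r * \<alpha> c z $ r $ s * g c z $ s $ j) x))"

definition xi_field :: "('n, 'p::finite) vfield \<Rightarrow> ('n, 'p) mfield \<Rightarrow> ('n, 'p) symbols \<Rightarrow>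
    ('n, 'p) vfield" where
  "xi_field b \<sigma> \<Gamma> c x =
     (\<chi> k. b c x $ k + (1/2) * (\<Sum>i\<in>UNIV. \<Sum>j\<in>UNIV. diffusion_variance \<sigma> c x $ i $ j * \<Gamma> c x k i j))"

text \<open>
  The flow \<open>(t, x) \<mapsto> \<phi>\<^sub>t(x)\<close>, \<open>t \<ge> 0\<close>, of a vector field. Joint \<open>C\<^sup>2\<close> regularity is automatic when
  \<open>\<xi>\<close> is \<open>C\<^sup>2\<close>.
\<close>

definition is_flow :: "('n::topological_space, 'p::finite) chart set \<Rightarrow> ('n, 'p) vfield \<Rightarrow>
    (real \<Rightarrow> 'n \<Rightarrow> 'n) \<Rightarrow> bool" where
  "is_flow A \<xi> \<phi> \<longleftrightarrow> Ck_family 2 {0..} A A \<phi> \<and>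
     (\<forall>x. \<phi> 0 x = x) \<and>
     (\<forall>x. \<forall>t\<ge>0. \<forall>c\<in>A. \<phi> t x \<in> cdom c \<longrightarrow>
        ((\<lambda>s. cmap c (\<phi> s x)) has_vector_derivative \<xi> c (\<phi> t x)) (at t within {0..}))"

text \<open>
  \<open>\<Pi>\<^sub>t = \<integral>\<^sub>0\<^sup>t (\<phi>\<^sub>-\<^sub>s)\<^sub>* \<alpha>(x\<^sub>s) ds\<close> in \<open>T\<^sub>x\<^sub>0N \<otimes> T\<^sub>x\<^sub>0N\<close>. The flow is given for nonnegative times only, so
  \<open>\<phi>\<^sub>-\<^sub>s\<close> is the inverse of the diffeomorphism \<open>\<phi>\<^sub>s\<close> from \<open>N\<close> onto its open image, which contains \<open>x\<^sub>s\<close>.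
\<close>

definition Pi_tensor :: "('n, 'p::finite) chart set \<Rightarrow> ('n, 'p) mfield \<Rightarrow> (real \<Rightarrow> 'n \<Rightarrow> 'n) \<Rightarrow>
    'n \<Rightarrow> real \<Rightarrow> ('n, 'p) tens2" where
  "Pi_tensor A \<alpha> \<phi> x0 t =
     (\<lambda>c. integral {0..t} (\<lambda>s. push2 A (inv (\<phi> s)) (\<phi> s x0) (\<lambda>c'. \<alpha> c' (\<phi> s x0)) c))"

text \<open>The derivative \<open>dP\<^sub>t/dt\<close> of a curve in a fixed tensor product, one-sided at \<open>t = 0\<close>.\<close>

definition tensor_rate :: "(real \<Rightarrow> ('n, 'p::finite) tens2) \<Rightarrow> real \<Rightarrow> ('n, 'p) tens2" where
  "tensor_rate P t = (\<lambda>c. vector_derivative (\<lambda>s. P s c) (at t within {0..}))"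

text \<open>
  The system for \<open>u\<^sup>\<gamma>\<close> on \<open>[0,\<gamma>\<^sub>1] \<times> [0,\<delta>\<^sub>1] \<times> N\<close>, an equation in the tangent space of \<open>M\<close> at
  \<open>u\<^sup>\<gamma>(t, x)\<close>.
\<close>

definition pde_solution :: "('n::topological_space, 'p::finite) chart set \<Rightarrow>
    ('m::topological_space, 'q::finite) chart set \<Rightarrow> ('n, 'p) symbols \<Rightarrow> ('m, 'q) symbols \<Rightarrow>
    ('n, 'p) vfield \<Rightarrow> ('n, 'p) mfield \<Rightarrow> ('n \<Rightarrow> 'm) \<Rightarrow> real \<Rightarrow> real \<Rightarrow>
    (real \<Rightarrow> real \<Rightarrow> 'n \<Rightarrow> 'm) \<Rightarrow> bool" where
  "pde_solution A B \<Gamma> \<Gamma>' \<xi> \<alpha> \<psi> \<gamma>1 \<delta>1 u \<longleftrightarrow>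
     Ck_family 2 ({0..\<gamma>1} \<times> {0..\<delta>1}) A B (\<lambda>(\<gamma>, t). u \<gamma> t) \<and>
     (\<forall>\<gamma>\<in>{0..\<gamma>1}.
        (\<forall>x. u \<gamma> 0 x = \<psi> x) \<and>
        (\<forall>t\<in>{0..\<delta>1}. \<forall>x. \<forall>c\<in>B. u \<gamma> t x \<in> cdom c \<longrightarrow>
           ((\<lambda>s. cmap c (u \<gamma> s x)) has_vector_derivative
              push A (u \<gamma> t) x (\<lambda>c'. \<xi> c' x) c +
              (\<gamma>/2) *\<^sub>R second_fund_form A \<Gamma> \<Gamma>' (u \<gamma> t) x (\<lambda>c'. \<alpha> c' x) c)
           (at t within {0..\<delta>1})))"

end

theory Submission
  imports Defs
begin

text \<open>
  The idea is to follow \<open>u\<^sup>\<gamma>\<close> backwards along the trajectory \<open>x\<^sub>t = \<phi>\<^sub>t(x\<^sub>0)\<close>. Put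
  \<open>w(\<gamma>, s) = u\<^sup>\<gamma>(s, x\<^sub>\<delta>\<^sub>-\<^sub>s)\<close>. In \<open>\<partial>w/\<partial>s\<close> the motion of the base point cancels the first order term of
  the equation, and what is left is \<open>(\<gamma>/2) \<nabla>du\<^sup>\<gamma>\<^sub>s(\<alpha>)\<close> at \<open>x\<^sub>\<delta>\<^sub>-\<^sub>s\<close> (\<open>transport_derivative\<close>). For \<open>\<gamma> = 0\<close>
  the curve \<open>w\<close> is constant, that is, \<open>u\<^sup>0\<^sub>s = \<psi> \<circ> \<phi>\<^sub>s\<close> (\<open>unperturbed_solution\<close>). For small \<open>\<gamma> > 0\<close>
  it stays in one chart of \<open>M\<close>, where integration from \<open>w(\<gamma>, 0) = \<psi>(x\<^sub>\<delta>)\<close> to \<open>w(\<gamma>, \<delta>) = u\<^sup>\<gamma>(\<delta>, x\<^sub>0)\<close>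
  gives \<open>\<gamma>/2\<close> times an integral that is continuous in \<open>\<gamma>\<close>. The derivative at \<open>0\<close> is therefore
  \<open>\<onehalf> \<integral>\<^sub>0\<^sup>\<delta> \<nabla>d(\<psi> \<circ> \<phi>\<^sub>\<delta>\<^sub>-\<^sub>t)(x\<^sub>t)(\<alpha>) dt\<close> (\<open>derivative_of_scaled_integral\<close>).

  The rest is the composition formula
  \<open>\<nabla>d(g \<circ> f)(T) = \<nabla>dg(f\<^sub>*T) + g\<^sub>*(\<nabla>df(T))\<close> (\<open>sff_chart_compose\<close>), used twice. Applied to \<open>\<psi> \<circ> \<phi>\<^sub>\<delta>\<^sub>-\<^sub>t\<close>
  it produces \<open>\<nabla>d\<psi>\<close>, evaluated on \<open>(\<phi>\<^sub>\<delta>\<^sub>-\<^sub>t)\<^sub>*\<alpha> = (\<phi>\<^sub>\<delta>)\<^sub>* d\<Pi>\<^sub>t/dt\<close>, and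
  \<open>\<psi>\<^sub>* \<nabla>d\<phi>\<^sub>\<delta>\<^sub>-\<^sub>t(x\<^sub>t)(\<alpha>)\<close>; applied to \<open>\<phi>\<^sub>\<delta> = \<phi>\<^sub>\<delta>\<^sub>-\<^sub>t \<circ> \<phi>\<^sub>t\<close> it turns the latter into
  \<open>\<psi>\<^sub>*{\<nabla>d\<phi>\<^sub>\<delta>(x\<^sub>0)(d\<Pi>\<^sub>t/dt) - (\<phi>\<^sub>\<delta>\<^sub>-\<^sub>t)\<^sub>* \<nabla>d\<phi>\<^sub>t(x\<^sub>0)(d\<Pi>\<^sub>t/dt)}\<close> (\<open>second_fund_form_flow_split\<close>).
  Integration over \<open>t\<close> gives the assertion (\<open>integral_second_fund_form_flow\<close>).

  Two groups of facts support this argument. First, \<open>\<phi>\<^sub>t\<close> has to be a semigroup of injective maps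
  with invertible differentials, so that \<open>(\<phi>\<^sub>-\<^sub>t)\<^sub>*\<alpha>\<close> is the inverse push-forward: uniqueness of
  integral curves gives the first two properties (\<open>flow_add\<close>, \<open>flow_inj\<close>), and closeness to the
  identity for small times, propagated along the trajectory, the third (\<open>flow_matrix_det\<close>). Second,
  the integrands have to be continuous although the chart in which they are evaluated jumps with the
  base point. Second fundamental forms do not depend on that chart (\<open>sff_chart_change\<close>, the
  composition formula for the identity map), the connection on \<open>N\<close> enters through the trace
  \<open>\<Sum>\<alpha>\<^sup>i\<^sup>j\<Gamma>\<^sup>k\<^sub>i\<^sub>j\<close>, which is \<open>2(\<xi> - b)\<close>, and the Christoffel symbols of \<open>M\<close> are continuous by Koszul's
  formula (\<open>levi_civita_continuous\<close>).
\<close>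

section \<open>Calculus of maps of finite order\<close>

lemma has_derivative_cong_on:
  assumes "x \<in> S" "\<And>y. y \<in> S \<Longrightarrow> f y = g y"
  shows "(f has_derivative D) (at x within S) \<longleftrightarrow> (g has_derivative D) (at x within S)"
  using assms by (metis has_derivative_transform)

lemma frechet_derivative_cong_on:
  assumes "x \<in> S" "\<And>y. y \<in> S \<Longrightarrow> f y = g y"
  shows "frechet_derivative f (at x within S) = frechet_derivative g (at x within S)"
  unfolding frechet_derivative_def using has_derivative_cong_on[OF assms] by simp

lemma Ck_on_cong:
  assumes "\<And>x. x \<in> S \<Longrightarrow> f x = g x"
  shows "Ck_on k f S \<longleftrightarrow> Ck_on k g S"
  using assms
proof (induction k arbitrary: f g)
  case 0
  then show ?case by (simp cong: continuous_on_cong)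
next
  case (Suc k)
  have "f differentiable (at x within S) \<longleftrightarrow> g differentiable (at x within S)" if "x \<in> S" for x
    unfolding differentiable_def using has_derivative_cong_on[OF that, of f g] Suc.prems by blast
  moreover have "Ck_on k (\<lambda>x. frechet_derivative f (at x within S) v) S \<longleftrightarrow>
      Ck_on k (\<lambda>x. frechet_derivative g (at x within S) v) S" for v
    by (rule Suc.IH) (metis frechet_derivative_cong_on Suc.prems)
  ultimately show ?case by auto
qed

lemma Ck_on_continuous: "Ck_on k f S \<Longrightarrow> continuous_on S f"
  by (cases k) (auto simp: continuous_on_eq_continuous_within intro: differentiable_imp_continuous_within)

lemma D1_eqI: "(f has_derivative D) (at y) \<Longrightarrow> D1 f y = D"
  unfolding D1_def[abs_def] using frechet_derivative_at by metis

lemma D1_cong: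
  assumes "open U" "y \<in> U" "\<And>z. z \<in> U \<Longrightarrow> f z = g z"
  shows "D1 f y = D1 g y"
proof -
  have "(f has_derivative D) (at y) \<longleftrightarrow> (g has_derivative D) (at y)" for D
    using has_derivative_transform_within_open[OF _ assms(1,2), of f D UNIV g]
      has_derivative_transform_within_open[OF _ assms(1,2), of g D UNIV f] assms(3) by auto
  then show ?thesis unfolding D1_def frechet_derivative_def by simp
qed

lemma D2_cong:
  assumes "open U" "y \<in> U" "\<And>z. z \<in> U \<Longrightarrow> f z = g z"
  shows "D2 f y = D2 g y"
proof -
  have "D1 (\<lambda>z. D1 f z v) y = D1 (\<lambda>z. D1 g z v) y" for v
    by (rule D1_cong[OF assms(1,2)]) (metis D1_cong assms(1,3))
  then show ?thesis unfolding D2_def by (intro ext) simp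
qed

text \<open>
  A fibre \<open>{z. (s, z) \<in> S}\<close> of \<open>S\<close> is open although \<open>S\<close> itself has boundary in the direction of the
  parameter \<open>s\<close>. Full derivatives along the fibres are therefore restrictions of the one-sided
  derivatives that define \<open>Ck_on\<close>, and they inherit joint regularity from them.
\<close>

lemma has_derivative_fibre:
  assumes "\<And>s. open {z. (s, z) \<in> S}" "(s, y) \<in> S"
    and "(f has_derivative D) (at (s, y) within S)"
  shows "((\<lambda>z. f (s, z)) has_derivative (\<lambda>v. D (0, v))) (at y)"
proof -
  have "((\<lambda>z. (s, z)) has_derivative (\<lambda>v. (0, v))) (at y within {z. (s, z) \<in> S})"
    by (auto intro!: derivative_eq_intros)
  moreover have "(f has_derivative D) (at (s, y) within (\<lambda>z. (s, z)) ` {z. (s, z) \<in> S})"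
    using assms(3) by (rule has_derivative_subset) auto
  ultimately have "((\<lambda>z. f (s, z)) has_derivative (\<lambda>v. D (0, v))) (at y within {z. (s, z) \<in> S})"
    by (rule has_derivative_in_compose)
  moreover have "at y within {z. (s, z) \<in> S} = at y"
    using assms(1,2) by (intro at_within_open) auto
  ultimately show ?thesis by simp
qed

lemma D1_fibre:
  assumes "\<And>s. open {z. (s, z) \<in> S}" "(s, y) \<in> S" "f differentiable (at (s, y) within S)"
  shows "((\<lambda>z. f (s, z)) has_derivative D1 (\<lambda>z. f (s, z)) y) (at y)"
    and "D1 (\<lambda>z. f (s, z)) y v = frechet_derivative f (at (s, y) within S) (0, v)"
proof -
  have "((\<lambda>z. f (s, z)) has_derivative
      (\<lambda>v. frechet_derivative f (at (s, y) within S) (0, v))) (at y)"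
    using has_derivative_fibre[OF assms(1,2)] assms(3) frechet_derivative_works by blast
  then show "((\<lambda>z. f (s, z)) has_derivative D1 (\<lambda>z. f (s, z)) y) (at y)"
    "D1 (\<lambda>z. f (s, z)) y v = frechet_derivative f (at (s, y) within S) (0, v)"
    using D1_eqI by metis+
qed

lemma Ck_on_fibre_D1:
  assumes "\<And>s. open {z. (s, z) \<in> S}" "Ck_on (Suc k) f S"
  shows "Ck_on k (\<lambda>p. D1 (\<lambda>z. f (fst p, z)) (snd p) v) S"
proof -
  have "Ck_on k (\<lambda>p. frechet_derivative f (at p within S) (0, v)) S"
    using assms(2) by simp
  moreover have "frechet_derivative f (at p within S) (0, v) = D1 (\<lambda>z. f (fst p, z)) (snd p) v"
    if "p \<in> S" for p
    using D1_fibre(2)[OF assms(1), of "fst p" "snd p" f v] that assms(2) by simp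
  ultimately show ?thesis
    by (subst Ck_on_cong[where g = "\<lambda>p. frechet_derivative f (at p within S) (0, v)"]) simp_all
qed

lemma Ck_on_fibre:
  assumes "\<And>s. open {z. (s, z) \<in> S}" "Ck_on k f S"
  shows "Ck_on k (\<lambda>z. f (s, z)) {z. (s, z) \<in> S}"
  using assms(2)
proof (induction k arbitrary: f)
  case 0
  have "continuous_on {z. (s, z) \<in> S} (\<lambda>z. f (s, z))"
    by (rule continuous_on_compose2[of S f]) (use 0 in \<open>auto intro!: continuous_intros\<close>)
  then show ?case by simp
next
  case (Suc k)
  let ?V = "{z. (s, z) \<in> S}"
  have at: "at y within ?V = at y" if "y \<in> ?V" for y
    using that assms(1) by (intro at_within_open) auto
  have "(\<lambda>z. f (s, z)) differentiable (at y)" if "y \<in> ?V" for y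
    using D1_fibre(1)[OF assms(1), of s y f] that Suc.prems
    by (auto intro: differentiableI)
  moreover have "Ck_on k (\<lambda>y. frechet_derivative (\<lambda>z. f (s, z)) (at y within ?V) v) ?V" for v
  proof -
    have "Ck_on k (\<lambda>y. D1 (\<lambda>z. f (s, z)) y v) ?V"
      using Suc.IH[OF Ck_on_fibre_D1[OF assms(1) Suc.prems, of v]] by simp
    then show ?thesis
      by (subst Ck_on_cong[where g = "\<lambda>y. D1 (\<lambda>z. f (s, z)) y v"]) (simp_all add: D1_def at)
  qed
  ultimately show ?case by (simp add: at)
qed

lemma continuous_on_fibre_D2:
  assumes "\<And>s. open {z. (s, z) \<in> S}" "Ck_on (Suc (Suc k)) f S"
  shows "continuous_on S (\<lambda>p. D2 (\<lambda>z. f (fst p, z)) (snd p) v w)"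
  using Ck_on_continuous[OF Ck_on_fibre_D1[OF assms(1) Ck_on_fibre_D1[OF assms], of v w]]
  unfolding D2_def by simp

lemma Ck_on_open_D1:
  assumes "open U" "Ck_on (Suc k) f U"
  shows "Ck_on k (\<lambda>y. D1 f y v) U"
  using assms
  by (subst Ck_on_cong[where g = "\<lambda>y. frechet_derivative f (at y within U) v"])
    (simp_all add: D1_def at_within_open[of _ U])

lemma Ck_on_open_has_derivative:
  assumes "open U" "Ck_on (Suc k) f U" "y \<in> U"
  shows "(f has_derivative D1 f y) (at y)"
  using assms by (auto simp: D1_def[abs_def] at_within_open[of _ U] frechet_derivative_works[symmetric])

lemma Ck_on_open_has_derivative_D1:
  assumes "open U" "Ck_on (Suc (Suc k)) f U" "y \<in> U"
  shows "((\<lambda>z. D1 f z v) has_derivative D2 f y v) (at y)"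
  using Ck_on_open_has_derivative[OF assms(1) Ck_on_open_D1[OF assms(1,2)] assms(3)]
  by (simp add: D2_def[abs_def])

lemma D2_linear_right:
  assumes "open U" "Ck_on (Suc (Suc k)) f U" "y \<in> U"
  shows "linear (D2 f y v)"
  using Ck_on_open_has_derivative_D1[OF assms] has_derivative_linear by blast

lemma D2_linear_left:
  assumes "open U" "Ck_on (Suc (Suc k)) f U" "y \<in> U"
  shows "linear (\<lambda>v. D2 f y v w)"
proof -
  have lin: "linear (D1 f z)" if "z \<in> U" for z
    using Ck_on_open_has_derivative[OF assms(1,2) that] has_derivative_linear by blast
  note der = Ck_on_open_has_derivative_D1[OF assms]
  have add: "D2 f y (a + b) = (\<lambda>w. D2 f y a w + D2 f y b w)" for a b
  proof -
    have "((\<lambda>z. D1 f z a + D1 f z b) has_derivative (\<lambda>w. D2 f y a w + D2 f y b w)) (at y)"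
      using der by (intro has_derivative_add) auto
    then have "((\<lambda>z. D1 f z (a + b)) has_derivative (\<lambda>w. D2 f y a w + D2 f y b w)) (at y)"
      by (rule has_derivative_transform_within_open[OF _ assms(1,3)]) (simp add: lin linear_add)
    then show ?thesis using der has_derivative_unique by blast
  qed
  have scale: "D2 f y (r *\<^sub>R a) = (\<lambda>w. r *\<^sub>R D2 f y a w)" for r a
  proof -
    have "((\<lambda>z. r *\<^sub>R D1 f z a) has_derivative (\<lambda>w. r *\<^sub>R D2 f y a w)) (at y)"
      using der by (intro has_derivative_scaleR_right) auto
    then have "((\<lambda>z. D1 f z (r *\<^sub>R a)) has_derivative (\<lambda>w. r *\<^sub>R D2 f y a w)) (at y)"
      by (rule has_derivative_transform_within_open[OF _ assms(1,3)]) (simp add: lin linear_cmul)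
    then show ?thesis using der has_derivative_unique by blast
  qed
  show ?thesis by (rule linearI) (simp_all add: add scale)
qed

lemma D1_compose:
  assumes "(F has_derivative D1 F y) (at y)" "(G has_derivative D1 G (F y)) (at (F y))"
  shows "D1 (G \<circ> F) y = D1 G (F y) \<circ> D1 F y"
  using assms by (intro D1_eqI diff_chain_at)

text \<open>
  The second order chain rule: \<open>D(G \<circ> F)(z) v = DG(F z)(DF(z) v)\<close> is differentiated in \<open>z\<close> as a sum
  over the components of \<open>DF(z) v\<close>, since only \<open>z \<mapsto> DG(z) i\<close> with fixed \<open>i\<close> is known to be
  differentiable.
\<close>

lemma D2_compose:
  fixes F :: "'a::real_normed_vector \<Rightarrow> 'b::euclidean_space" and G :: "'b \<Rightarrow> 'c::real_normed_vector"
  assumes U: "open U" "Ck_on 2 F U" "y \<in> U" and V: "open V" "Ck_on 2 G V" "F y \<in> V"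
  shows "D2 (G \<circ> F) y v w = D2 G (F y) (D1 F y v) (D1 F y w) + D1 G (F y) (D2 F y v w)"
proof -
  have U2: "Ck_on (Suc (Suc 0)) F U" and V2: "Ck_on (Suc (Suc 0)) G V"
    using U V by (simp_all add: numeral_2_eq_2)
  have "continuous_on U F" using U(2) Ck_on_continuous by blast
  then have W: "open (U \<inter> F -` V)" using U(1) V(1) by (simp add: continuous_on_open_vimage Int_commute)
  have Fd: "(F has_derivative D1 F z) (at z)" if "z \<in> U" for z
    by (rule Ck_on_open_has_derivative[OF U(1) U2 that])
  have Gd: "(G has_derivative D1 G z) (at z)" if "z \<in> V" for z
    by (rule Ck_on_open_has_derivative[OF V(1) V2 that])
  have expand: "D1 G z a = (\<Sum>i\<in>Basis. (a \<bullet> i) *\<^sub>R D1 G z i)" if "z \<in> V" for z a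
  proof -
    have "linear (D1 G z)" using Gd[OF that] has_derivative_linear by blast
    then have "D1 G z (\<Sum>i\<in>Basis. (a \<bullet> i) *\<^sub>R i) = (\<Sum>i\<in>Basis. (a \<bullet> i) *\<^sub>R D1 G z i)"
      by (simp add: linear_sum linear_cmul)
    then show ?thesis by (simp add: euclidean_representation)
  qed
  have "((\<lambda>z. D1 G (F z) i) has_derivative (\<lambda>w. D2 G (F y) i (D1 F y w))) (at y)" for i
    using diff_chain_at[OF Fd[OF U(3)] Ck_on_open_has_derivative_D1[OF V(1) V2 V(3), of i]]
    by (simp add: o_def)
  then have der: "((\<lambda>z. \<Sum>i\<in>Basis. (D1 F z v \<bullet> i) *\<^sub>R D1 G (F z) i) has_derivative
      (\<lambda>w. \<Sum>i\<in>Basis. (D1 F y v \<bullet> i) *\<^sub>R D2 G (F y) i (D1 F y w) + (D2 F y v w \<bullet> i) *\<^sub>R D1 G (F y) i)) (at y)"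
    using Ck_on_open_has_derivative_D1[OF U(1) U2 U(3), of v]
    by (intro has_derivative_sum has_derivative_scaleR has_derivative_inner_left) auto
  have D1GF: "D1 (G \<circ> F) z v = (\<Sum>i\<in>Basis. (D1 F z v \<bullet> i) *\<^sub>R D1 G (F z) i)"
    if "z \<in> U \<inter> F -` V" for z
    using D1_compose[OF Fd Gd, of z] that expand[of "F z" "D1 F z v", symmetric] by simp
  have "y \<in> U \<inter> F -` V" using U(3) V(3) by simp
  then have "((\<lambda>z. D1 (G \<circ> F) z v) has_derivative
      (\<lambda>w. \<Sum>i\<in>Basis. (D1 F y v \<bullet> i) *\<^sub>R D2 G (F y) i (D1 F y w) + (D2 F y v w \<bullet> i) *\<^sub>R D1 G (F y) i)) (at y)"
    using D1GF[symmetric] by (rule has_derivative_transform_within_open[OF der W])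
  from D1_eqI[OF this] have "D2 (G \<circ> F) y v w = (\<Sum>i\<in>Basis.
      (D1 F y v \<bullet> i) *\<^sub>R D2 G (F y) i (D1 F y w) + (D2 F y v w \<bullet> i) *\<^sub>R D1 G (F y) i)"
    by (simp only: D2_def[of "G \<circ> F"])
  also have "\<dots> =
      (\<Sum>i\<in>Basis. (D1 F y v \<bullet> i) *\<^sub>R D2 G (F y) i (D1 F y w)) + D1 G (F y) (D2 F y v w)"
    by (simp only: sum.distrib expand[OF V(3), of "D2 F y v w"])
  also have "(\<Sum>i\<in>Basis. (D1 F y v \<bullet> i) *\<^sub>R D2 G (F y) i (D1 F y w)) =
      D2 G (F y) (\<Sum>i\<in>Basis. (D1 F y v \<bullet> i) *\<^sub>R i) (D1 F y w)"
    by (simp add: linear_sum[OF D2_linear_left[OF V(1) V2 V(3)]] linear_cmul[OF D2_linear_left[OF V(1) V2 V(3)]])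
  finally show ?thesis by (simp only: euclidean_representation)
qed

section \<open>Tensors and matrices\<close>

lemma on_tensor_add: "on_tensor (\<lambda>v w. B v w + C v w) T = on_tensor B T + on_tensor C T"
  by (simp add: on_tensor_def scaleR_add_right sum.distrib)

lemma on_tensor_diff: "on_tensor (\<lambda>v w. B v w - C v w) T = on_tensor B T - on_tensor C T"
  by (simp add: on_tensor_def scaleR_diff_right sum_subtractf)

lemma on_tensor_linear_image:
  assumes "linear f"
  shows "on_tensor (\<lambda>v w. f (B v w)) T = f (on_tensor B T)"
  using assms by (simp add: on_tensor_def linear_sum linear_cmul)

lemma on_tensor_linear: "linear (on_tensor B)"
  by (rule linearI)
    (simp_all add: on_tensor_def scaleR_add_left sum.distrib scaleR_sum_right)

text \<open>
  Pulling a bilinear map back along \<open>L\<close> amounts to pushing the tensor forward along \<open>L \<otimes> L\<close>.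
\<close>

lemma on_tensor_matrix:
  fixes T :: "real^'p::finite^'p" and L :: "real^'p \<Rightarrow> real^'q::finite"
  assumes B: "\<And>v. linear (B v)" "\<And>w. linear (\<lambda>v. B v w)" and L: "linear L"
  shows "on_tensor (\<lambda>v w. B (L v) (L w)) T = on_tensor B (matrix L ** T ** transpose (matrix L))"
proof -
  have basis: "(\<Sum>k\<in>UNIV. x $ k *\<^sub>R axis k 1) = x" for x :: "real^'q"
    using basis_expansion[of x] by (simp add: scalar_mult_eq_scaleR)
  have expand: "B x y = (\<Sum>k\<in>UNIV. \<Sum>l\<in>UNIV. (x $ k * y $ l) *\<^sub>R B (axis k 1) (axis l 1))" for x y
  proof -
    have "B x y = B (\<Sum>k\<in>UNIV. x $ k *\<^sub>R axis k 1) y"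
      by (simp only: basis)
    also have "\<dots> = (\<Sum>k\<in>UNIV. x $ k *\<^sub>R B (axis k 1) y)"
      by (simp add: linear_sum[OF B(2)[of y]] linear_cmul[OF B(2)[of y]])
    also have "\<dots> = (\<Sum>k\<in>UNIV. x $ k *\<^sub>R B (axis k 1) (\<Sum>l\<in>UNIV. y $ l *\<^sub>R axis l 1))"
      by (simp only: basis)
    also have "\<dots> = (\<Sum>k\<in>UNIV. x $ k *\<^sub>R (\<Sum>l\<in>UNIV. y $ l *\<^sub>R B (axis k 1) (axis l 1)))"
      using B(1) by (simp add: linear_sum linear_cmul)
    finally show ?thesis by (simp add: scaleR_sum_right)
  qed
  let ?E = "\<lambda>k l. B (axis k 1) (axis l 1)"
  have "on_tensor (\<lambda>v w. B (L v) (L w)) T =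
      (\<Sum>i\<in>UNIV. \<Sum>j\<in>UNIV. \<Sum>k\<in>UNIV. \<Sum>l\<in>UNIV.
        (T $ i $ j * L (axis i 1) $ k * L (axis j 1) $ l) *\<^sub>R ?E k l)"
    unfolding on_tensor_def
    by (intro sum.cong refl, subst expand) (simp add: scaleR_sum_right mult.assoc)
  also have "\<dots> = (\<Sum>k\<in>UNIV. \<Sum>l\<in>UNIV. \<Sum>j\<in>UNIV. \<Sum>i\<in>UNIV.
        (T $ i $ j * L (axis i 1) $ k * L (axis j 1) $ l) *\<^sub>R ?E k l)"
    (is "(\<Sum>i\<in>_. \<Sum>j\<in>_. \<Sum>k\<in>_. \<Sum>l\<in>_. ?h i j k l) = _")
  proof -
    have "(\<Sum>i\<in>UNIV. \<Sum>j\<in>UNIV. \<Sum>k\<in>UNIV. \<Sum>l\<in>UNIV. ?h i j k l) = (\<Sum>i\<in>UNIV. \<Sum>k\<in>UNIV. \<Sum>j\<in>UNIV. \<Sum>l\<in>UNIV. ?h i j k l)"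
      by (rule sum.cong[OF refl], rule sum.swap)
    also have "\<dots> = (\<Sum>k\<in>UNIV. \<Sum>i\<in>UNIV. \<Sum>j\<in>UNIV. \<Sum>l\<in>UNIV. ?h i j k l)"
      by (rule sum.swap)
    also have "\<dots> = (\<Sum>k\<in>UNIV. \<Sum>i\<in>UNIV. \<Sum>l\<in>UNIV. \<Sum>j\<in>UNIV. ?h i j k l)"
      by (rule sum.cong[OF refl], rule sum.cong[OF refl], rule sum.swap)
    also have "\<dots> = (\<Sum>k\<in>UNIV. \<Sum>l\<in>UNIV. \<Sum>i\<in>UNIV. \<Sum>j\<in>UNIV. ?h i j k l)"
      by (rule sum.cong[OF refl], rule sum.swap)
    also have "\<dots> = (\<Sum>k\<in>UNIV. \<Sum>l\<in>UNIV. \<Sum>j\<in>UNIV. \<Sum>i\<in>UNIV. ?h i j k l)"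
      by (rule sum.cong[OF refl], rule sum.cong[OF refl], rule sum.swap)
    finally show ?thesis .
  qed
  also have "\<dots> = on_tensor B (matrix L ** T ** transpose (matrix L))"
  proof -
    have "(matrix L ** T ** transpose (matrix L)) $ k $ l =
        (\<Sum>j\<in>UNIV. \<Sum>i\<in>UNIV. T $ i $ j * L (axis i 1) $ k * L (axis j 1) $ l)" for k l
      by (simp add: matrix_matrix_mult_def transpose_def matrix_def sum_distrib_left sum_distrib_right mult_ac)
    then show ?thesis by (simp add: on_tensor_def scaleR_sum_left)
  qed
  finally show ?thesis .
qed

lemma matrix_inv_inverse:
  fixes M :: "real^'n::finite^'n"
  assumes "det M \<noteq> 0"
  shows "M ** matrix_inv M = mat 1" "matrix_inv M ** M = mat 1"
proof -
  have "\<exists>N. M ** N = mat 1 \<and> N ** M = mat 1"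
    using assms invertible_det_nz[of M] by (simp add: invertible_def)
  then have "M ** matrix_inv M = mat 1 \<and> matrix_inv M ** M = mat 1"
    unfolding matrix_inv_def by (rule someI_ex)
  then show "M ** matrix_inv M = mat 1" "matrix_inv M ** M = mat 1" by auto
qed

lemma continuous_on_det:
  fixes M :: "'a::topological_space \<Rightarrow> real^'n::finite^'n"
  assumes "\<And>i j. continuous_on S (\<lambda>x. M x $ i $ j)"
  shows "continuous_on S (\<lambda>x. det (M x))"
  unfolding det_def
  by (intro continuous_on_sum continuous_on_mult continuous_on_const continuous_on_prod assms)

text \<open>
  Cramer's rule makes the solution a quotient of determinants. This serves for inverse matrices and
  for raising the index of Christoffel symbols.
\<close>

lemma continuous_on_linear_solution:
  fixes M :: "'a::topological_space \<Rightarrow> real^'n::finite^'n"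
  assumes M: "\<And>i j. continuous_on S (\<lambda>x. M x $ i $ j)" and b: "\<And>i. continuous_on S (\<lambda>x. b x $ i)"
    and inv: "\<And>x. x \<in> S \<Longrightarrow> det (M x) \<noteq> 0" and sol: "\<And>x. x \<in> S \<Longrightarrow> M x *v v x = b x"
  shows "continuous_on S (\<lambda>x. v x $ k)"
proof -
  have "continuous_on S (\<lambda>x. det (\<chi> i j. if j = k then b x $ i else M x $ i $ j) / det (M x))"
  proof (intro continuous_on_divide continuous_on_det ballI M inv)
    show "continuous_on S (\<lambda>x. (\<chi> i j. if j = k then b x $ i else M x $ i $ j) $ i $ j)" for i j
      using M b by (cases "j = k") auto
  qed auto
  moreover have "v x $ k = det (\<chi> i j. if j = k then b x $ i else M x $ i $ j) / det (M x)"
    if "x \<in> S" for x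
    using cramer[OF inv[OF that], of "v x" "b x"] sol[OF that] by simp
  ultimately show ?thesis by (simp cong: continuous_on_cong)
qed

lemma continuous_on_matrix_inv:
  fixes M :: "'a::topological_space \<Rightarrow> real^'n::finite^'n"
  assumes M: "\<And>i j. continuous_on S (\<lambda>x. M x $ i $ j)" and inv: "\<And>x. x \<in> S \<Longrightarrow> det (M x) \<noteq> 0"
  shows "continuous_on S (\<lambda>x. matrix_inv (M x) $ i $ j)"
proof -
  have "continuous_on S (\<lambda>x. (matrix_inv (M x) *v axis j 1) $ i)"
  proof (rule continuous_on_linear_solution[OF M _ inv])
    show "M x *v (matrix_inv (M x) *v axis j 1) = axis j 1" if "x \<in> S" for x
      using inv[OF that] by (simp add: matrix_inv_inverse matrix_vector_mul_assoc)
  qed auto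
  then show ?thesis by (simp add: matrix_vector_mul_component column_def inner_axis)
qed

section \<open>Maps between manifolds in charts\<close>

lemma smooth_atlasD:
  assumes "smooth_atlas A" "c \<in> A"
  shows "open (cdom c)" "open (cimg c)" "inj_on (cmap c) (cdom c)"
    "continuous_on (cdom c) (cmap c)" "continuous_on (cimg c) (cinv c)"
  using assms unfolding smooth_atlas_def homeomorphism_def by (auto intro!: inj_on_inverseI)

lemma chart_at:
  assumes "smooth_atlas A"
  shows "chart_at A x \<in> A" "x \<in> cdom (chart_at A x)"
proof -
  have "\<exists>c. c \<in> A \<and> x \<in> cdom c"
    using assms unfolding smooth_atlas_def by (metis UNIV_I UN_E)
  then have "chart_at A x \<in> A \<and> x \<in> cdom (chart_at A x)"
    unfolding chart_at_def by (rule someI_ex)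
  then show "chart_at A x \<in> A" "x \<in> cdom (chart_at A x)" by auto
qed

text \<open>
  Twice differentiability near \<open>x\<close> as seen in one pair of charts, on a neighbourhood that \<open>f\<close> maps
  into the target chart. This is what makes local representatives of compositions compose.
\<close>

definition C2_at :: "('n, 'p::finite) chart \<Rightarrow> ('m, 'q::finite) chart \<Rightarrow> ('n \<Rightarrow> 'm) \<Rightarrow> 'n \<Rightarrow> bool" where
  "C2_at c c' f x \<longleftrightarrow> x \<in> cdom c \<and> inj_on (cmap c) (cdom c) \<and> inj_on (cmap c') (cdom c') \<and>
     (\<exists>U. open U \<and> cmap c x \<in> U \<and> U \<subseteq> cimg c \<and> Ck_on 2 (local_rep c c' f) U \<and>
       (\<forall>y\<in>U. f (cinv c y) \<in> cdom c'))"

lemma C2_atI: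
  assumes "smooth_atlas A" "c \<in> A" "smooth_atlas B" "c' \<in> B" "x \<in> cdom c"
    and "open U" "cmap c x \<in> U" "U \<subseteq> cimg c" "Ck_on 2 (local_rep c c' f) U"
    and "\<And>y. y \<in> U \<Longrightarrow> f (cinv c y) \<in> cdom c'"
  shows "C2_at c c' f x"
  unfolding C2_at_def
  by (intro conjI exI[of _ U] ballI smooth_atlasD(3)[OF assms(1,2)] smooth_atlasD(3)[OF assms(3,4)]
      assms(5-10))

lemma C2_at_local_rep:
  assumes "C2_at c c' f x"
  shows "local_rep c c' f (cmap c x) = cmap c' (f x)"
  using assms by (simp add: C2_at_def local_rep_def)

lemma C2_at_has_derivative:
  assumes "C2_at c c' f x"
  shows "(local_rep c c' f has_derivative D1 (local_rep c c' f) (cmap c x)) (at (cmap c x))"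
  using assms Ck_on_open_has_derivative unfolding C2_at_def by (metis numeral_2_eq_2)

lemma C2_at_linear:
  assumes "C2_at c c' f x"
  shows "linear (D1 (local_rep c c' f) (cmap c x))"
  using C2_at_has_derivative[OF assms] has_derivative_linear by blast

lemma C2_at_linear_D2:
  assumes "C2_at c c' f x"
  shows "linear (D2 (local_rep c c' f) (cmap c x) v)" "linear (\<lambda>v. D2 (local_rep c c' f) (cmap c x) v w)"
  using assms D2_linear_left D2_linear_right unfolding C2_at_def by (metis numeral_2_eq_2)+

lemma C2_at_compose:
  assumes f: "C2_at c0 c1 f x" and g: "C2_at c1 c2 g (f x)"
  shows "D1 (local_rep c0 c2 (g \<circ> f)) (cmap c0 x) =
      D1 (local_rep c1 c2 g) (cmap c1 (f x)) \<circ> D1 (local_rep c0 c1 f) (cmap c0 x)"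
    and "D2 (local_rep c0 c2 (g \<circ> f)) (cmap c0 x) v w =
      D2 (local_rep c1 c2 g) (cmap c1 (f x))
        (D1 (local_rep c0 c1 f) (cmap c0 x) v) (D1 (local_rep c0 c1 f) (cmap c0 x) w) +
      D1 (local_rep c1 c2 g) (cmap c1 (f x)) (D2 (local_rep c0 c1 f) (cmap c0 x) v w)"
proof -
  obtain U where U: "open U" "cmap c0 x \<in> U" "Ck_on 2 (local_rep c0 c1 f) U"
      "\<And>y. y \<in> U \<Longrightarrow> f (cinv c0 y) \<in> cdom c1"
    using f unfolding C2_at_def by blast
  obtain V where V: "open V" "cmap c1 (f x) \<in> V" "Ck_on 2 (local_rep c1 c2 g) V"
    using g unfolding C2_at_def by blast
  have inj: "inj_on (cmap c1) (cdom c1)" using g unfolding C2_at_def by blast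
  have eq: "local_rep c0 c2 (g \<circ> f) z = (local_rep c1 c2 g \<circ> local_rep c0 c1 f) z" if "z \<in> U" for z
    using U(4)[OF that] inj by (simp add: local_rep_def)
  have y: "local_rep c0 c1 f (cmap c0 x) = cmap c1 (f x)" by (rule C2_at_local_rep[OF f])
  show "D1 (local_rep c0 c2 (g \<circ> f)) (cmap c0 x) =
      D1 (local_rep c1 c2 g) (cmap c1 (f x)) \<circ> D1 (local_rep c0 c1 f) (cmap c0 x)"
  proof -
    have "D1 (local_rep c0 c2 (g \<circ> f)) (cmap c0 x) =
        D1 (local_rep c1 c2 g \<circ> local_rep c0 c1 f) (cmap c0 x)"
      by (rule D1_cong[OF U(1,2) eq])
    then show ?thesis
      using D1_compose[OF C2_at_has_derivative[OF f], of "local_rep c1 c2 g"] C2_at_has_derivative[OF g]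
      by (simp add: y)
  qed
  show "D2 (local_rep c0 c2 (g \<circ> f)) (cmap c0 x) v w =
      D2 (local_rep c1 c2 g) (cmap c1 (f x))
        (D1 (local_rep c0 c1 f) (cmap c0 x) v) (D1 (local_rep c0 c1 f) (cmap c0 x) w) +
      D1 (local_rep c1 c2 g) (cmap c1 (f x)) (D2 (local_rep c0 c1 f) (cmap c0 x) v w)"
  proof -
    have "D2 (local_rep c0 c2 (g \<circ> f)) (cmap c0 x) =
        D2 (local_rep c1 c2 g \<circ> local_rep c0 c1 f) (cmap c0 x)"
      by (rule D2_cong[OF U(1,2) eq])
    then show ?thesis
      using D2_compose[OF U(1,3,2) V(1,3), of v w] V(2) by (simp add: y)
  qed
qed

lemma C2_at_compose_matrix:
  assumes f: "C2_at c0 c1 f x" and g: "C2_at c1 c2 g (f x)"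
  shows "matrix (D1 (local_rep c0 c2 (g \<circ> f)) (cmap c0 x)) =
      matrix (D1 (local_rep c1 c2 g) (cmap c1 (f x))) ** matrix (D1 (local_rep c0 c1 f) (cmap c0 x))"
  using C2_at_compose(1)[OF assms] matrix_compose[OF C2_at_linear[OF f] C2_at_linear[OF g]] by simp

lemma open_chart_preimage:
  assumes A: "smooth_atlas A" "c \<in> A" and B: "smooth_atlas B" "c' \<in> B" and f: "continuous_on UNIV f"
  shows "open {y \<in> cimg c. f (cinv c y) \<in> cdom c'}"
proof -
  have "continuous_on (cimg c) (\<lambda>y. f (cinv c y))"
    by (rule continuous_on_compose2[OF f smooth_atlasD(5)[OF A]]) auto
  then have "open ((\<lambda>y. f (cinv c y)) -` cdom c' \<inter> cimg c)"
    using continuous_on_open_vimage[OF smooth_atlasD(2)[OF A]] smooth_atlasD(1)[OF B] by blast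
  then show ?thesis by (simp add: vimage_def Collect_conj_eq Int_commute)
qed

lemma C2_at_Ck_map:
  assumes A: "smooth_atlas A" "c \<in> A" and B: "smooth_atlas B" "c' \<in> B" and f: "Ck_map 2 A B f"
    and x: "x \<in> cdom c" "f x \<in> cdom c'"
  shows "C2_at c c' f x"
proof -
  let ?U = "{y \<in> cimg c. f (cinv c y) \<in> cdom c'}"
  have "open ?U" using open_chart_preimage[OF A B] f unfolding Ck_map_def by blast
  moreover have "cmap c x \<in> ?U" using x smooth_atlasD(3)[OF A] by simp
  moreover have "Ck_on 2 (local_rep c c' f) ?U" using f A B unfolding Ck_map_def local_rep_def by blast
  ultimately show ?thesis
    using C2_atI[OF A B x(1), of ?U] by simp
qed

lemma C2_at_id:
  assumes A: "smooth_atlas A" "c \<in> A" "c' \<in> A" and x: "x \<in> cdom c" "x \<in> cdom c'"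
  shows "C2_at c c' id x"
proof (rule C2_at_Ck_map[OF A(1,2) A(1,3)])
  have "Ck_on 2 (cmap d' \<circ> id \<circ> cinv d) {y \<in> cimg d. id (cinv d y) \<in> cdom d'}"
    if "d \<in> A" "d' \<in> A" for d d'
  proof -
    have "{y \<in> cimg d. id (cinv d y) \<in> cdom d'} = cmap d ` (cdom d \<inter> cdom d')"
      using smooth_atlasD(3)[OF A(1) that(1)] by auto
    moreover have "Ck_on 2 (cmap d' \<circ> cinv d) (cmap d ` (cdom d \<inter> cdom d'))"
      using A(1) that unfolding smooth_atlas_def by blast
    ultimately show ?thesis by simp
  qed
  then show "Ck_map 2 A A id" by (simp add: Ck_map_def)
qed (use x in auto)

abbreviation family_dom where
  "family_dom S F c c' \<equiv> {(s, y). s \<in> S \<and> y \<in> cimg c \<and> F s (cinv c y) \<in> cdom c'}"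

lemma Ck_family_continuous:
  assumes "Ck_family k S A B F" "continuous_on Q p" "continuous_on Q x" "\<And>q. q \<in> Q \<Longrightarrow> p q \<in> S"
  shows "continuous_on Q (\<lambda>q. F (p q) (x q))"
proof -
  have "continuous_on (S \<times> UNIV) (\<lambda>(s, x). F s x)" using assms(1) unfolding Ck_family_def by blast
  from continuous_on_compose2[OF this, of Q "\<lambda>q. (p q, x q)"] assms(2-4) show ?thesis
    by (auto intro: continuous_on_Pair)
qed

lemma Ck_family_fibre_open:
  assumes A: "smooth_atlas A" "c \<in> A" and B: "smooth_atlas B" "c' \<in> B" and F: "Ck_family k S A B F"
  shows "open {y. (s, y) \<in> family_dom S F c c'}"
proof (cases "s \<in> S")
  case True
  have "continuous_on UNIV (F s)"
    using Ck_family_continuous[OF F, of UNIV "\<lambda>_. s" "\<lambda>x. x"] True by simp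
  then show ?thesis using open_chart_preimage[OF A B] True by simp
qed simp

lemma C2_at_family:
  assumes A: "smooth_atlas A" "c \<in> A" and B: "smooth_atlas B" "c' \<in> B" and F: "Ck_family 2 S A B F"
    and s: "s \<in> S" and x: "x \<in> cdom c" "F s x \<in> cdom c'"
  shows "C2_at c c' (F s) x"
proof -
  let ?U = "{y. (s, y) \<in> family_dom S F c c'}"
  note op = Ck_family_fibre_open[OF A B F]
  have "Ck_on 2 (\<lambda>(s, y). cmap c' (F s (cinv c y))) (family_dom S F c c')"
    using F A B unfolding Ck_family_def by blast
  from Ck_on_fibre[OF op this, of s] have "Ck_on 2 (local_rep c c' (F s)) ?U"
    by (simp add: local_rep_def o_def)
  moreover have "cmap c x \<in> ?U" using s x smooth_atlasD(3)[OF A] by simp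
  ultimately show ?thesis
    using C2_atI[OF A B x(1) op[of s]] by simp
qed

lemma Ck_family_continuous_derivatives:
  assumes A: "smooth_atlas A" "c \<in> A" and B: "smooth_atlas B" "c' \<in> B" and F: "Ck_family 2 S A B F"
    and p: "continuous_on Q p" "\<And>q. q \<in> Q \<Longrightarrow> p q \<in> S"
    and x: "continuous_on Q x" "\<And>q. q \<in> Q \<Longrightarrow> x q \<in> cdom c"
    and Fx: "\<And>q. q \<in> Q \<Longrightarrow> F (p q) (x q) \<in> cdom c'"
  shows "continuous_on Q (\<lambda>q. D1 (local_rep c c' (F (p q))) (cmap c (x q)) v)"
    and "continuous_on Q (\<lambda>q. D2 (local_rep c c' (F (p q))) (cmap c (x q)) v w)"
proof -
  let ?f = "\<lambda>(s, y). cmap c' (F s (cinv c y))" and ?S = "family_dom S F c c'"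
  note op = Ck_family_fibre_open[OF A B F]
  have Ck: "Ck_on (Suc (Suc 0)) ?f ?S"
    using F A B unfolding Ck_family_def numeral_2_eq_2 by blast
  have "continuous_on Q (\<lambda>q. cmap c (x q))"
    using continuous_on_compose2[OF smooth_atlasD(4)[OF A] x(1)] x(2) by blast
  then have cont: "continuous_on Q (\<lambda>q. (p q, cmap c (x q)))"
    using p(1) by (intro continuous_on_Pair)
  have sub: "(\<lambda>q. (p q, cmap c (x q))) ` Q \<subseteq> ?S"
    using p(2) x(2) Fx smooth_atlasD(3)[OF A] by auto
  show "continuous_on Q (\<lambda>q. D1 (local_rep c c' (F (p q))) (cmap c (x q)) v)"
    using continuous_on_compose2[OF Ck_on_continuous[OF Ck_on_fibre_D1[OF op Ck, of v]] cont sub]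
    by (simp add: local_rep_def o_def)
  show "continuous_on Q (\<lambda>q. D2 (local_rep c c' (F (p q))) (cmap c (x q)) v w)"
    using continuous_on_compose2[OF continuous_on_fibre_D2[OF op Ck, of v w] cont sub]
    by (simp add: local_rep_def o_def)
qed

section \<open>Second fundamental forms and changes of charts\<close>

text \<open>The second fundamental form computed in a chart \<open>c\<close> of the source instead of the chosen one.\<close>

definition sff_chart ::
  "('n, 'p::finite) symbols \<Rightarrow> ('m, 'q::finite) symbols \<Rightarrow> ('n, 'p) chart \<Rightarrow> ('m, 'q) chart \<Rightarrow>
    ('n \<Rightarrow> 'm) \<Rightarrow> 'n \<Rightarrow> real^'p^'p \<Rightarrow> real^'q" where
  "sff_chart \<Gamma> \<Gamma>' c c' f x = on_tensor (\<lambda>v w. D2 (local_rep c c' f) (cmap c x) v w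
     - D1 (local_rep c c' f) (cmap c x) (connector \<Gamma> c x v w)
     + connector \<Gamma>' c' (f x) (D1 (local_rep c c' f) (cmap c x) v) (D1 (local_rep c c' f) (cmap c x) w))"

lemma second_fund_form_sff_chart:
  "second_fund_form A \<Gamma> \<Gamma>' f x T c' = sff_chart \<Gamma> \<Gamma>' (chart_at A x) c' f x (T (chart_at A x))"
  by (simp add: second_fund_form_def sff_chart_def Let_def)

lemma sff_chart_linear: "linear (sff_chart \<Gamma> \<Gamma>' c c' f x)"
  unfolding sff_chart_def by (rule on_tensor_linear)

lemma connector_linear: "linear (connector \<Gamma> c x v)" "linear (\<lambda>v. connector \<Gamma> c x v w)"
  by (rule linearI; simp add: connector_def vec_eq_iff algebra_simps sum.distrib sum_distrib_left)+

text \<open>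
  The connection of the middle manifold cancels: it enters \<open>\<nabla>dg\<close> with one sign and \<open>\<nabla>df\<close> with the
  other.
\<close>

lemma sff_chart_compose:
  fixes c0 :: "('n, 'p::finite) chart" and c1 :: "('m, 'q::finite) chart" and c2 :: "('k, 'r::finite) chart"
  assumes f: "C2_at c0 c1 f x" and g: "C2_at c1 c2 g (f x)"
  defines "L \<equiv> matrix (D1 (local_rep c0 c1 f) (cmap c0 x))"
  shows "sff_chart \<Gamma> \<Gamma>'' c0 c2 (g \<circ> f) x T =
    sff_chart \<Gamma>' \<Gamma>'' c1 c2 g (f x) (L ** T ** transpose L) +
    D1 (local_rep c1 c2 g) (cmap c1 (f x)) (sff_chart \<Gamma> \<Gamma>' c0 c1 f x T)"
proof -
  let ?F = "D1 (local_rep c0 c1 f) (cmap c0 x)" and ?F2 = "D2 (local_rep c0 c1 f) (cmap c0 x)"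
  let ?G = "D1 (local_rep c1 c2 g) (cmap c1 (f x))" and ?G2 = "D2 (local_rep c1 c2 g) (cmap c1 (f x))"
  note G = C2_at_linear[OF g]
  define B where "B v w = ?G2 v w - ?G (connector \<Gamma>' c1 (f x) v w)
      + connector \<Gamma>'' c2 (g (f x)) (?G v) (?G w)" for v w
  have "linear (B v)" for v
    unfolding B_def
    by (intro linear_compose_add linear_compose_sub C2_at_linear_D2[OF g]
        linear_compose[OF connector_linear(1) G, unfolded o_def]
        linear_compose[OF G connector_linear(1), unfolded o_def])
  moreover have "linear (\<lambda>v. B v w)" for w
    unfolding B_def
    by (intro linear_compose_add linear_compose_sub C2_at_linear_D2[OF g]
        linear_compose[OF connector_linear(2) G, unfolded o_def]
        linear_compose[OF G connector_linear(2), unfolded o_def])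
  ultimately have "on_tensor (\<lambda>v w. B (?F v) (?F w)) T = on_tensor B (L ** T ** transpose L)"
    unfolding L_def by (rule on_tensor_matrix) (rule C2_at_linear[OF f])
  moreover have "on_tensor (\<lambda>v w. ?G (?F2 v w - ?F (connector \<Gamma> c0 x v w)
      + connector \<Gamma>' c1 (f x) (?F v) (?F w))) T = ?G (sff_chart \<Gamma> \<Gamma>' c0 c1 f x T)"
    unfolding sff_chart_def by (rule on_tensor_linear_image[OF G])
  moreover have "sff_chart \<Gamma> \<Gamma>'' c0 c2 (g \<circ> f) x T = on_tensor (\<lambda>v w. B (?F v) (?F w)
      + ?G (?F2 v w - ?F (connector \<Gamma> c0 x v w) + connector \<Gamma>' c1 (f x) (?F v) (?F w))) T"
    unfolding sff_chart_def B_def C2_at_compose[OF f g]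
    by (simp add: linear_add[OF G] linear_diff[OF G] algebra_simps)
  ultimately show ?thesis
    by (simp add: on_tensor_add sff_chart_def B_def[abs_def])
qed

text \<open>
  For \<open>T = \<alpha>\<close> the source connection appears here as the trace \<open>\<Sum>\<alpha>\<^sup>i\<^sup>j\<Gamma>\<^sup>k\<^sub>i\<^sub>j\<close>, whose continuity is
  known. The differential is expanded in the standard basis because its values on fixed vectors are
  what depends continuously on a parameter.
\<close>

lemma sff_chart_split:
  assumes "C2_at c c' f x"
  shows "sff_chart \<Gamma> \<Gamma>' c c' f x T = on_tensor (D2 (local_rep c c' f) (cmap c x)) T
     - (\<Sum>k\<in>UNIV. on_tensor (connector \<Gamma> c x) T $ k *\<^sub>R D1 (local_rep c c' f) (cmap c x) (axis k 1))
     + on_tensor (\<lambda>v w. connector \<Gamma>' c' (f x) (D1 (local_rep c c' f) (cmap c x) v)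
         (D1 (local_rep c c' f) (cmap c x) w)) T"
proof -
  note F = C2_at_linear[OF assms]
  have expand: "D1 (local_rep c c' f) (cmap c x) z =
      (\<Sum>k\<in>UNIV. z $ k *\<^sub>R D1 (local_rep c c' f) (cmap c x) (axis k 1))" for z
  proof -
    have "D1 (local_rep c c' f) (cmap c x) (\<Sum>k\<in>UNIV. z $ k *\<^sub>R axis k 1) =
      (\<Sum>k\<in>UNIV. z $ k *\<^sub>R D1 (local_rep c c' f) (cmap c x) (axis k 1))"
      by (simp add: linear_sum[OF F] linear_cmul[OF F])
    then show ?thesis using basis_expansion[of z] by (simp add: scalar_mult_eq_scaleR)
  qed
  show ?thesis
    unfolding sff_chart_def on_tensor_add on_tensor_diff on_tensor_linear_image[OF F]
      expand[of "on_tensor (connector \<Gamma> c x) T", symmetric] by (rule refl)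
qed

definition tensor_field :: "('n, 'p::finite) chart set \<Rightarrow> ('n, 'p) mfield \<Rightarrow> bool" where
  "tensor_field A \<alpha> \<longleftrightarrow> (\<forall>c\<in>A. \<forall>c'\<in>A. \<forall>x\<in>cdom c \<inter> cdom c'.
     let J = matrix (transition_D1 c c' x) in \<alpha> c' x = J ** \<alpha> c x ** transpose J)"

lemma transition_local_rep_id:
  "transition_D1 c c' x = D1 (local_rep c c' id) (cmap c x)"
  "transition_D2 c c' x = D2 (local_rep c c' id) (cmap c x)"
  by (simp_all add: transition_D1_def transition_D2_def local_rep_def)

text \<open>
  Independence of the source chart is the composition formula for \<open>g \<circ> id\<close>, with the identity read in
  two charts.
\<close>

lemma sff_chart_change:
  assumes A: "smooth_atlas A" "c0 \<in> A" "c1 \<in> A" and \<Gamma>: "is_connection A \<Gamma>" and \<alpha>: "tensor_field A \<alpha>"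
    and x: "x \<in> cdom c0" and g: "C2_at c1 c2 g x"
  shows "sff_chart \<Gamma> \<Gamma>' c0 c2 g x (\<alpha> c0 x) = sff_chart \<Gamma> \<Gamma>' c1 c2 g x (\<alpha> c1 x)"
proof -
  have x1: "x \<in> cdom c1" using g unfolding C2_at_def by blast
  note i = C2_at_id[OF A(1-3) x x1]
  \<comment> \<open>the transformation law of Christoffel symbols says that the identity has no second fundamental form\<close>
  have "sff_chart \<Gamma> \<Gamma> c0 c1 id x T = 0" for T
    using \<Gamma> A x x1
    by (simp add: sff_chart_def is_connection_def transition_local_rep_id[symmetric] on_tensor_def)
  moreover define J where "J = matrix (D1 (local_rep c0 c1 id) (cmap c0 x))"
  moreover have "J ** \<alpha> c0 x ** transpose J = \<alpha> c1 x"
    using \<alpha>[unfolded tensor_field_def Let_def, rule_format, OF A(2,3), of x] x x1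
    unfolding transition_local_rep_id J_def by simp
  ultimately show ?thesis
    using sff_chart_compose[OF i, of c2 g \<Gamma> \<Gamma>' "\<alpha> c0 x" \<Gamma>] g linear_0[OF C2_at_linear[OF g]]
    by simp
qed

lemma continuous_on_locally:
  fixes f :: "'a::t2_space \<Rightarrow> 'b::topological_space"
  assumes "\<And>q. q \<in> Q \<Longrightarrow> \<exists>W. open W \<and> q \<in> W \<and> continuous_on (Q \<inter> W) f"
  shows "continuous_on Q f"
  unfolding continuous_on_eq_continuous_within
proof
  fix q assume "q \<in> Q"
  with assms obtain W where "open W" "q \<in> W" "continuous_on (Q \<inter> W) f" by blast
  moreover from this have "at q within Q = at q within (Q \<inter> W)" by (intro at_within_nhd) auto
  ultimately show "continuous (at q within Q) f"
    using \<open>q \<in> Q\<close> by (simp add: continuous_on_eq_continuous_within)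
qed


lemma on_tensor_continuous:
  fixes B :: "'a::topological_space \<Rightarrow> real^'p::finite \<Rightarrow> real^'p \<Rightarrow> 'b::real_normed_vector"
  assumes "\<And>i j. continuous_on Q (\<lambda>q. B q (axis i 1) (axis j 1))" "\<And>i j. continuous_on Q (\<lambda>q. T q $ i $ j)"
  shows "continuous_on Q (\<lambda>q. on_tensor (B q) (T q))"
  unfolding on_tensor_def by (intro continuous_intros assms)

lemma continuous_on_component2:
  assumes "continuous_on Q T"
  shows "continuous_on Q (\<lambda>q. T q $ i $ j)"
  using assms by (intro continuous_intros)

text \<open>
  The chart in which \<open>second_fund_form\<close> is evaluated jumps with the base point; the invariance under
  changes of charts makes it possible to hold it fixed locally.
\<close>

lemma second_fund_form_continuous:
  fixes A :: "('n::{t2_space,second_countable_topology}, 'p::finite) chart set"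
    and B :: "('m::{t2_space,second_countable_topology}, 'q::finite) chart set"
    and p :: "'c::t2_space \<Rightarrow> 's::real_normed_vector"
  assumes A: "smooth_atlas A" and B: "smooth_atlas B" "c' \<in> B" and \<Gamma>: "is_connection A \<Gamma>"
    and \<alpha>: "tensor_field A \<alpha>" "\<And>c. c \<in> A \<Longrightarrow> continuous_on (cdom c) (\<alpha> c)"
    and trace: "\<And>c. c \<in> A \<Longrightarrow> continuous_on (cdom c) (\<lambda>x. on_tensor (connector \<Gamma> c x) (\<alpha> c x))"
    and F: "Ck_family 2 S A B F"
    and p: "continuous_on Q p" "\<And>q. q \<in> Q \<Longrightarrow> p q \<in> S"
    and x: "continuous_on Q x" and Fx: "\<And>q. q \<in> Q \<Longrightarrow> F (p q) (x q) \<in> cdom c'"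
    and \<Gamma>': "\<And>i j k. continuous_on Q (\<lambda>q. \<Gamma>' c' (F (p q) (x q)) k i j)"
  shows "continuous_on Q (\<lambda>q. second_fund_form A \<Gamma> \<Gamma>' (F (p q)) (x q) (\<lambda>c. \<alpha> c (x q)) c')"
proof (rule continuous_on_locally)
  fix q0 assume q0: "q0 \<in> Q"
  define c where "c = chart_at A (x q0)"
  have c: "c \<in> A" "x q0 \<in> cdom c" unfolding c_def using chart_at[OF A] by auto
  have "open (cdom c)" using smooth_atlasD(1)[OF A c(1)] .
  then obtain W where W: "open W" "W \<inter> Q = x -` cdom c \<inter> Q"
    using x unfolding continuous_on_open_invariant by blast
  define R where "R = Q \<inter> W"
  have R: "R \<subseteq> Q" "\<And>q. q \<in> R \<Longrightarrow> x q \<in> cdom c" using W(2) unfolding R_def by auto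
  have xR: "continuous_on R x" and pR: "continuous_on R p" using x p R(1) continuous_on_subset by blast+
  have reg: "C2_at c c' (F (p q)) (x q)" if "q \<in> R" for q
    using C2_at_family[OF A c(1) B F] p(2) Fx R that by blast
  have eq: "second_fund_form A \<Gamma> \<Gamma>' (F (p q)) (x q) (\<lambda>c. \<alpha> c (x q)) c' =
      sff_chart \<Gamma> \<Gamma>' c c' (F (p q)) (x q) (\<alpha> c (x q))" if "q \<in> R" for q
    using sff_chart_change[OF A chart_at(1)[OF A] c(1) \<Gamma> \<alpha>(1) chart_at(2)[OF A] reg[OF that]]
    by (simp add: second_fund_form_sff_chart)
  note D = Ck_family_continuous_derivatives[OF A c(1) B F pR _ xR R(2)]
  have D1: "continuous_on R (\<lambda>q. D1 (local_rep c c' (F (p q))) (cmap c (x q)) v)"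
    and D2: "continuous_on R (\<lambda>q. D2 (local_rep c c' (F (p q))) (cmap c (x q)) v w)" for v w
    using D p(2) Fx R(1) by blast+
  have \<alpha>R: "continuous_on R (\<lambda>q. \<alpha> c (x q))"
    by (rule continuous_on_compose2[OF \<alpha>(2)[OF c(1)] xR]) (use R(2) in auto)
  have tr: "continuous_on R (\<lambda>q. on_tensor (connector \<Gamma> c (x q)) (\<alpha> c (x q)))"
    by (rule continuous_on_compose2[OF trace[OF c(1)] xR]) (use R(2) in auto)
  have \<Gamma>R: "continuous_on R (\<lambda>q. \<Gamma>' c' (F (p q) (x q)) k i j)" for i j k
    using \<Gamma>' R(1) continuous_on_subset by blast
  have "continuous_on R (\<lambda>q. sff_chart \<Gamma> \<Gamma>' c c' (F (p q)) (x q) (\<alpha> c (x q)))"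
  proof (rule continuous_on_eq)
    show "continuous_on R (\<lambda>q. on_tensor (D2 (local_rep c c' (F (p q))) (cmap c (x q))) (\<alpha> c (x q))
     - (\<Sum>k\<in>UNIV. on_tensor (connector \<Gamma> c (x q)) (\<alpha> c (x q)) $ k *\<^sub>R
          D1 (local_rep c c' (F (p q))) (cmap c (x q)) (axis k 1))
     + on_tensor (\<lambda>v w. connector \<Gamma>' c' (F (p q) (x q)) (D1 (local_rep c c' (F (p q))) (cmap c (x q)) v)
         (D1 (local_rep c c' (F (p q))) (cmap c (x q)) w)) (\<alpha> c (x q)))"
      unfolding connector_def[of \<Gamma>']
      by (intro continuous_on_add continuous_on_diff on_tensor_continuous D2 continuous_on_sum
          continuous_on_scaleR D1 continuous_on_component2[OF \<alpha>R] continuous_on_component tr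
          continuous_on_vec_lambda continuous_on_mult \<Gamma>R)
  qed (simp add: sff_chart_split[OF reg])
  then have "continuous_on R (\<lambda>q. second_fund_form A \<Gamma> \<Gamma>' (F (p q)) (x q) (\<lambda>c. \<alpha> c (x q)) c')"
    by (rule continuous_on_eq) (simp add: eq)
  moreover have "q0 \<in> W" using W(2) q0 c(2) by auto
  ultimately show "\<exists>W. open W \<and> q0 \<in> W \<and> continuous_on (Q \<inter> W)
      (\<lambda>q. second_fund_form A \<Gamma> \<Gamma>' (F (p q)) (x q) (\<lambda>c. \<alpha> c (x q)) c')"
    unfolding R_def using W(1) by blast
qed

section \<open>Regularity of the coefficients\<close>

lemma Ck_field_continuous:
  assumes "smooth_atlas A" "c \<in> A" "Ck_field k A V"
  shows "continuous_on (cdom c) (V c)"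
proof -
  have "continuous_on (cimg c) (\<lambda>y. V c (cinv c y))"
    using assms Ck_on_continuous unfolding Ck_field_def by blast
  from continuous_on_compose2[OF this smooth_atlasD(4)[OF assms(1,2)]]
  have "continuous_on (cdom c) (\<lambda>x. V c (cinv c (cmap c x)))" by auto
  then show ?thesis
    by (rule continuous_on_eq) (simp add: smooth_atlasD(3)[OF assms(1,2)])
qed

text \<open>
  Koszul's formula: metric compatibility and symmetry express the lowered Christoffel symbols
  through the first derivatives of the metric, and the metric is inverted by Cramer's rule.
\<close>

lemma levi_civita_continuous:
  assumes B: "smooth_atlas B" "c \<in> B" and h: "riemannian_metric B h" and lc: "levi_civita B h \<Gamma>"
  shows "continuous_on (cdom c) (\<lambda>x. \<Gamma> c x k i j)"
proof -
  define d where "d l a e x = partial_deriv c l (\<lambda>z. h c z $ a $ e) x" for l a e x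
  have d: "continuous_on (cdom c) (d l a e)" for l a e
  proof -
    have Ck: "Ck_on (Suc 0) (\<lambda>y. h c (cinv c y)) (cimg c)"
      using h B unfolding riemannian_metric_def Ck_field_def One_nat_def by blast
    note op = smooth_atlasD(2)[OF B]
    have "D1 (\<lambda>y. h c (cinv c y) $ a $ e) y v = D1 (\<lambda>y. h c (cinv c y)) y v $ a $ e"
      if "y \<in> cimg c" for y v
    proof -
      have "bounded_linear (\<lambda>M::real^'b^'b. M $ a $ e)"
        using bounded_linear_compose[OF bounded_linear_vec_nth bounded_linear_vec_nth] .
      from bounded_linear.has_derivative[OF this Ck_on_open_has_derivative[OF op Ck that]]
      show ?thesis using D1_eqI by metis
    qed
    moreover have "continuous_on (cimg c) (\<lambda>y. D1 (\<lambda>y. h c (cinv c y)) y (axis l 1) $ a $ e)"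
      using Ck_on_open_D1[OF op Ck] by (intro continuous_on_component2) simp
    ultimately have "continuous_on (cimg c) (\<lambda>y. D1 (\<lambda>y. h c (cinv c y) $ a $ e) y (axis l 1))"
      by (simp cong: continuous_on_cong)
    from continuous_on_compose2[OF this smooth_atlasD(4)[OF B]] show ?thesis
      unfolding d_def[abs_def] partial_deriv_def by (auto simp: o_def)
  qed
  define L where "L m a e x = (\<Sum>l\<in>UNIV. \<Gamma> c x l m a * h c x $ l $ e)" for m a e x
  have hsym: "h c x $ a $ e = h c x $ e $ a" if "x \<in> cdom c" for x a e
  proof -
    have "transpose (h c x) = h c x" using h B that unfolding riemannian_metric_def by blast
    then have "transpose (h c x) $ e $ a = h c x $ e $ a" by simp
    then show ?thesis by (simp add: transpose_def)
  qed
  have Koszul: "L m a e x = (d m a e x + d a m e x - d e m a x) / 2" if x: "x \<in> cdom c" for m a e x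
  proof -
    have D: "d m a e x = L m a e x + L m e a x" for m a e
      using lc B x hsym[OF x] unfolding levi_civita_def d_def L_def by (simp add: sum.distrib)
    have S: "L m a e x = L a m e x" for m a e
      using lc B x unfolding levi_civita_def L_def by (metis (no_types, lifting))
    show ?thesis
      using D[of m a e] D[of a m e] D[of e m a] S[of a m e] S[of e m a] S[of e a m] by simp
  qed
  show ?thesis
  proof (rule continuous_on_linear_solution[where M = "h c" and v = "\<lambda>x. \<chi> l. \<Gamma> c x l i j"
        and b = "\<lambda>x. \<chi> e. L i j e x" and k = k, simplified])
    show "continuous_on (cdom c) (\<lambda>x. h c x $ a $ e)" for a e
      using Ck_field_continuous[OF B] h unfolding riemannian_metric_def
      by (intro continuous_on_component2) blast
    show "continuous_on (cdom c) (L i j e)" for e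
    proof (rule continuous_on_eq)
      show "continuous_on (cdom c) (\<lambda>x. (d i j e x + d j i e x - d e i j x) / 2)"
        by (intro continuous_intros d) auto
    qed (simp add: Koszul)
    show "det (h c x) \<noteq> 0" if "x \<in> cdom c" for x
    proof
      assume "det (h c x) = 0"
      then obtain v where "v \<noteq> 0" "h c x *v v = 0"
        using invertible_det_nz[of "h c x"] matrix_left_invertible_ker[of "h c x"]
        by (auto simp: invertible_left_inverse)
      moreover have "v \<bullet> (h c x *v v) > 0"
        using h B that \<open>v \<noteq> 0\<close> unfolding riemannian_metric_def by blast
      ultimately show False by simp
    qed
    show "h c x *v (\<chi> l. \<Gamma> c x l i j) = (\<chi> e. L i j e x)" if "x \<in> cdom c" for x
      using hsym[OF that] by (simp add: vec_eq_iff matrix_vector_mult_def L_def mult.commute)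
  qed
qed

lemma diffusion_variance_tensor_field:
  assumes A: "smooth_atlas A" and "diffusion A b \<sigma> r"
  shows "tensor_field A (diffusion_variance \<sigma>)"
  unfolding tensor_field_def Let_def
proof (intro ballI)
  fix c c' x assume c: "c \<in> A" "c' \<in> A" "x \<in> cdom c \<inter> cdom c'"
  let ?J = "matrix (transition_D1 c c' x)"
  have "linear (transition_D1 c c' x)"
    unfolding transition_local_rep_id using c(3) by (intro C2_at_linear C2_at_id[OF A c(1,2)]) auto
  then have J: "?J *v z = transition_D1 c c' x z" for z
    by (simp add: matrix_works)
  have "\<sigma> c' x *v w = transition_D1 c c' x (\<sigma> c x *v w)" for w
    using assms(2) c unfolding diffusion_def by blast
  then have "\<sigma> c' x *v w = (?J ** \<sigma> c x) *v w" for w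
    by (simp only: J[symmetric] matrix_vector_mul_assoc)
  then have "\<sigma> c' x = ?J ** \<sigma> c x"
    by (simp add: matrix_eq)
  then show "diffusion_variance \<sigma> c' x = ?J ** diffusion_variance \<sigma> c x ** transpose ?J"
    by (simp add: diffusion_variance_def matrix_transpose_mul matrix_mul_assoc)
qed

lemma diffusion_variance_continuous:
  assumes "smooth_atlas A" "c \<in> A" "Ck_field k A \<sigma>"
  shows "continuous_on (cdom c) (diffusion_variance \<sigma> c)"
proof -
  have "continuous_on (cdom c) (\<lambda>x. \<sigma> c x $ i $ j)" for i j
    using Ck_field_continuous[OF assms] by (rule continuous_on_component2)
  then show ?thesis
    unfolding diffusion_variance_def[abs_def] matrix_matrix_mult_def transpose_def
    by (auto intro!: continuous_on_vec_lambda continuous_on_sum continuous_on_mult)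
qed

text \<open>
  The field \<open>\<xi>\<close> contains half the trace of the connection, so the trace is continuous because
  \<open>\<xi>\<close> and the drift are.
\<close>

lemma xi_field_trace:
  "on_tensor (connector \<Gamma> c x) (diffusion_variance \<sigma> c x) = 2 *\<^sub>R (xi_field b \<sigma> \<Gamma> c x - b c x)"
proof -
  have "(\<Sum>a\<in>UNIV. \<Sum>e\<in>UNIV. \<Gamma> c x k a e * axis i 1 $ a * axis j 1 $ e) = \<Gamma> c x k i j" for k i j
  proof -
    have "(\<Sum>e\<in>UNIV. \<Gamma> c x k a e * axis i 1 $ a * axis j 1 $ e) =
        (if a = i then \<Gamma> c x k i j else 0)" for a
    proof -
      have "(\<Sum>e\<in>UNIV. \<Gamma> c x k a e * axis i 1 $ a * axis j 1 $ e) =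
          (\<Sum>e\<in>UNIV. if e = j then \<Gamma> c x k a j * axis i 1 $ a else 0)"
        by (rule sum.cong) (auto simp: axis_def)
      then show ?thesis by (simp add: axis_def)
    qed
    then show ?thesis by simp
  qed
  then show ?thesis
    by (simp add: vec_eq_iff on_tensor_def connector_def xi_field_def)
qed

lemma trace_continuous:
  assumes "smooth_atlas A" "c \<in> A" "Ck_field k A b" "Ck_field j A (xi_field b \<sigma> \<Gamma>)"
  shows "continuous_on (cdom c) (\<lambda>x. on_tensor (connector \<Gamma> c x) (diffusion_variance \<sigma> c x))"
  unfolding xi_field_trace[of \<Gamma> c _ \<sigma> b]
  using Ck_field_continuous[OF assms(1,2,3)] Ck_field_continuous[OF assms(1,2,4)]
  by (intro continuous_intros)

section \<open>Uniqueness of integral curves\<close>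

text \<open>
  Connectedness in the form in which it propagates a property along a trajectory: equality of two
  integral curves, invertibility of the differential of a flow, constancy of a curve.
\<close>

lemma interval_local_induction:
  fixes s t T :: real
  assumes "s \<in> {0..T}" "t \<in> {0..T}" "P s"
    and loc: "\<And>r. r \<in> {0..T} \<Longrightarrow>
      \<exists>e>0. \<forall>x\<in>{0..T}. \<forall>y\<in>{0..T}. dist x r < e \<longrightarrow> dist y r < e \<longrightarrow> P x \<longrightarrow> P y"
  shows "P t"
proof (rule connected_induction_simple[of "{0..T}"])
  fix r assume r: "r \<in> {0..T}"
  then obtain e where e: "e > 0"
      "\<forall>x\<in>{0..T}. \<forall>y\<in>{0..T}. dist x r < e \<longrightarrow> dist y r < e \<longrightarrow> P x \<longrightarrow> P y"
    using loc by blast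
  have "openin (top_of_set {0..T}) ({0..T} \<inter> ball r e)" by (rule openin_open_Int) simp
  moreover have "r \<in> {0..T} \<inter> ball r e" using r e(1) by simp
  moreover have "\<forall>x \<in> {0..T} \<inter> ball r e. \<forall>y \<in> {0..T} \<inter> ball r e. P x \<longrightarrow> P y"
  proof (intro ballI impI)
    fix x y assume "x \<in> {0..T} \<inter> ball r e" "y \<in> {0..T} \<inter> ball r e" "P x"
    then have "x \<in> {0..T}" "y \<in> {0..T}" "dist x r < e" "dist y r < e" by (auto simp: dist_commute)
    with e(2) \<open>P x\<close> show "P y" by blast
  qed
  ultimately show "\<exists>U. openin (top_of_set {0..T}) U \<and> r \<in> U \<and> (\<forall>x\<in>U. \<forall>y\<in>U. P x \<longrightarrow> P y)"
    by blast
qed (use assms in auto)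

lemma continuous_on_ball_in_open:
  assumes "continuous_on I a" "open W" "t \<in> I" "a t \<in> W"
  obtains e where "e > 0" "\<And>s. s \<in> I \<Longrightarrow> dist s t < e \<Longrightarrow> a s \<in> W"
proof -
  obtain V where V: "open V" "V \<inter> I = a -` W \<inter> I"
    using assms(1,2) unfolding continuous_on_open_invariant by blast
  moreover have "t \<in> V" using V(2) assms(3,4) by blast
  ultimately obtain e where "e > 0" "ball t e \<subseteq> V" using open_contains_ball by blast
  have "a s \<in> W" if "s \<in> I" "dist s t < e" for s
  proof -
    have "s \<in> ball t e" using that(2) by (simp add: dist_commute)
    then show ?thesis using \<open>ball t e \<subseteq> V\<close> V(2) that(1) by blast
  qed
  then show ?thesis using that \<open>e > 0\<close> by blast
qed

lemma C1_locally_Lipschitz: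
  fixes f :: "'a::euclidean_space \<Rightarrow> 'b::real_normed_vector"
  assumes U: "open U" "Ck_on (Suc k) f U" and y: "y \<in> U"
  obtains r L where "r > 0" "L \<ge> 0" "cball y r \<subseteq> U"
    "\<And>a b. a \<in> cball y r \<Longrightarrow> b \<in> cball y r \<Longrightarrow> norm (f a - f b) \<le> L * norm (a - b)"
proof -
  obtain r where r: "r > 0" "cball y r \<subseteq> U" using U(1) y open_contains_cball by blast
  have der: "(f has_derivative D1 f z) (at z)" if "z \<in> cball y r" for z
    using Ck_on_open_has_derivative[OF U] that r(2) by blast
  have "continuous_on U (\<lambda>z. D1 f z i)" for i
    by (rule Ck_on_continuous[OF Ck_on_open_D1[OF U]])
  then have "continuous_on (cball y r) (\<lambda>z. \<Sum>i\<in>Basis. norm (D1 f z i))"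
    using r(2) continuous_on_subset by (intro continuous_intros) blast
  then have "bounded ((\<lambda>z. \<Sum>i\<in>Basis. norm (D1 f z i)) ` cball y r)"
    by (intro compact_imp_bounded compact_continuous_image) auto
  then obtain L where L: "L > 0" "\<And>z. z \<in> cball y r \<Longrightarrow> (\<Sum>i\<in>Basis. norm (D1 f z i)) \<le> L"
    unfolding bounded_pos by (force simp: abs_le_iff)
  have "onorm (D1 f z) \<le> L" if z: "z \<in> cball y r" for z
  proof (rule onorm_le)
    fix v
    have lin: "linear (D1 f z)" using der[OF z] has_derivative_linear by blast
    have "D1 f z v = D1 f z (\<Sum>i\<in>Basis. (v \<bullet> i) *\<^sub>R i)" by (simp only: euclidean_representation)
    also have "\<dots> = (\<Sum>i\<in>Basis. (v \<bullet> i) *\<^sub>R D1 f z i)"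
      by (simp add: linear_sum[OF lin] linear_cmul[OF lin])
    also have "norm \<dots> \<le> (\<Sum>i\<in>Basis. norm v * norm (D1 f z i))"
      by (rule sum_norm_le) (simp add: Basis_le_norm mult_right_mono)
    also have "\<dots> \<le> norm v * L"
      using L(2)[OF z] by (simp add: sum_distrib_left[symmetric] mult_left_mono)
    finally show "norm (D1 f z v) \<le> L * norm v" by (simp add: mult.commute)
  qed
  then have "norm (f a - f b) \<le> L * norm (a - b)" if "a \<in> cball y r" "b \<in> cball y r" for a b
    using differentiable_bound[OF convex_cball has_derivative_at_withinI[OF der], of y r L a b] that
    by blast
  then show ?thesis using that[OF r(1) _ r(2), of L] L(1) by auto
qed

text \<open>
  On times within half the inverse Lipschitz constant of \<open>t0\<close>, the mean value inequality bounds the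
  maximum of \<open>norm f\<close> by half of itself. It runs in both time directions at once, which
  gives forward uniqueness as well as the injectivity of a flow.
\<close>

lemma Lipschitz_ode_zero:
  fixes f :: "real \<Rightarrow> 'a::real_normed_vector"
  assumes I: "convex I" "compact I" "t0 \<in> I" "\<And>t. t \<in> I \<Longrightarrow> L * \<bar>t - t0\<bar> \<le> 1 / 2" and L: "L \<ge> 0"
    and f: "\<And>t. t \<in> I \<Longrightarrow> (f has_vector_derivative f' t) (at t within I)"
    and f': "\<And>t. t \<in> I \<Longrightarrow> norm (f' t) \<le> L * norm (f t)" and 0: "f t0 = 0"
    and t: "t \<in> I"
  shows "f t = 0"
proof -
  have "continuous_on I f" using f has_vector_derivative_continuous continuous_on_eq_continuous_within by blast
  then have "continuous_on I (\<lambda>t. norm (f t))" by (intro continuous_intros)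
  then obtain t1 where t1: "t1 \<in> I" "\<And>t. t \<in> I \<Longrightarrow> norm (f t) \<le> norm (f t1)"
    using continuous_attains_sup[OF I(2)] I(3) by blast
  have "norm (f t1 - f t0) \<le> (L * norm (f t1)) * norm (t1 - t0)"
  proof (rule differentiable_bound[OF I(1)])
    show "(f has_derivative (\<lambda>h. h *\<^sub>R f' t)) (at t within I)" if "t \<in> I" for t
      using f[OF that] by (simp add: has_vector_derivative_def)
    show "onorm (\<lambda>h. h *\<^sub>R f' t) \<le> L * norm (f t1)" if "t \<in> I" for t
    proof (rule onorm_le)
      have "norm (f' t) \<le> L * norm (f t1)"
        using f'[OF that] mult_left_mono[OF t1(2)[OF that] L] by linarith
      then show "norm (h *\<^sub>R f' t) \<le> L * norm (f t1) * norm h" for h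
        using mult_right_mono[of "norm (f' t)" "L * norm (f t1)" "norm h"] by (simp add: mult.commute)
    qed
  qed (use t1 I in auto)
  also have "\<dots> = (L * \<bar>t1 - t0\<bar>) * norm (f t1)" by simp
  also have "\<dots> \<le> (1 / 2) * norm (f t1)" by (rule mult_right_mono[OF I(4)[OF t1(1)]]) simp
  finally have "norm (f t1) \<le> 0" using 0 by simp
  then show ?thesis using t1(2)[OF t] by simp
qed

definition integral_curve_on ::
    "('n::topological_space, 'p::finite) chart set \<Rightarrow> ('n, 'p) vfield \<Rightarrow> real set \<Rightarrow> (real \<Rightarrow> 'n) \<Rightarrow> bool" where
  "integral_curve_on A \<xi> I a \<longleftrightarrow> continuous_on I a \<and>
     (\<forall>t\<in>I. \<forall>c\<in>A. a t \<in> cdom c \<longrightarrow>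
        ((\<lambda>s. cmap c (a s)) has_vector_derivative \<xi> c (a t)) (at t within I))"

text \<open>
  Coincidence of the curves persists nearby by the Lipschitz estimate in a chart, and distinctness
  persists nearby by the Hausdorff property.
\<close>

lemma integral_curve_unique:
  fixes A :: "('n::{t2_space,second_countable_topology}, 'p::finite) chart set"
  assumes A: "smooth_atlas A" and \<xi>: "Ck_field (Suc k) A \<xi>"
    and a: "integral_curve_on A \<xi> {0..T} a" and b: "integral_curve_on A \<xi> {0..T} b"
    and s: "s \<in> {0..T}" "a s = b s" and t: "t \<in> {0..T}"
  shows "a t = b t"
proof (rule interval_local_induction[where P = "\<lambda>t. a t = b t", OF s(1) t s(2)])
  fix t assume t: "t \<in> {0..T}"
  have ca: "continuous_on {0..T} a" and cb: "continuous_on {0..T} b"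
    using a b unfolding integral_curve_on_def by auto
  show "\<exists>e>0. \<forall>x\<in>{0..T}. \<forall>y\<in>{0..T}. dist x t < e \<longrightarrow> dist y t < e \<longrightarrow> a x = b x \<longrightarrow> a y = b y"
  proof (cases "a t = b t")
    case False
    then obtain U V where UV: "open U" "open V" "a t \<in> U" "b t \<in> V" "U \<inter> V = {}"
      using hausdorff[OF False] by blast
    obtain e1 where e1: "e1 > 0" "\<And>s. s \<in> {0..T} \<Longrightarrow> dist s t < e1 \<Longrightarrow> a s \<in> U"
      using continuous_on_ball_in_open[OF ca UV(1) t UV(3)] by blast
    obtain e2 where e2: "e2 > 0" "\<And>s. s \<in> {0..T} \<Longrightarrow> dist s t < e2 \<Longrightarrow> b s \<in> V"
      using continuous_on_ball_in_open[OF cb UV(2) t UV(4)] by blast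
    have "a x \<noteq> b x" if "x \<in> {0..T}" "dist x t < min e1 e2" for x
      using e1(2)[OF that(1)] e2(2)[OF that(1)] that(2) UV(5) by auto
    then show ?thesis using e1(1) e2(1) by (intro exI[of _ "min e1 e2"]) auto
  next
    case True
    define c where "c = chart_at A (a t)"
    have c: "c \<in> A" "a t \<in> cdom c" unfolding c_def using chart_at[OF A] by auto
    note inj = smooth_atlasD(3)[OF A c(1)]
    have Ck: "Ck_on (Suc k) (\<lambda>y. \<xi> c (cinv c y)) (cimg c)" using \<xi> c unfolding Ck_field_def by blast
    have y: "cmap c (a t) \<in> cimg c" using c(2) by (rule imageI)
    obtain r L where rL: "r > 0" "L \<ge> 0"
        "\<And>p q. p \<in> cball (cmap c (a t)) r \<Longrightarrow> q \<in> cball (cmap c (a t)) r \<Longrightarrow>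
          norm (\<xi> c (cinv c p) - \<xi> c (cinv c q)) \<le> L * norm (p - q)"
      by (rule C1_locally_Lipschitz[OF smooth_atlasD(2)[OF A c(1)] Ck y]) blast
    define W where "W = cmap c -` ball (cmap c (a t)) r \<inter> cdom c"
    have W: "open W" "a t \<in> W" "b t \<in> W"
      unfolding W_def using c(2) rL(1) True
        continuous_on_open_vimage[OF smooth_atlasD(1)[OF A c(1)]] smooth_atlasD(4)[OF A c(1)] by auto
    obtain e1 where e1: "e1 > 0" "\<And>s. s \<in> {0..T} \<Longrightarrow> dist s t < e1 \<Longrightarrow> a s \<in> W"
      using continuous_on_ball_in_open[OF ca W(1) t W(2)] by blast
    obtain e2 where e2: "e2 > 0" "\<And>s. s \<in> {0..T} \<Longrightarrow> dist s t < e2 \<Longrightarrow> b s \<in> W"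
      using continuous_on_ball_in_open[OF cb W(1) t W(3)] by blast
    define e where "e = min (min e1 e2 / 2) (1 / (2 * (L + 1)))"
    have e: "e > 0" "e < e1" "e < e2" "L * e \<le> 1 / 2"
    proof -
      show "e > 0" "e < e1" "e < e2" unfolding e_def using e1(1) e2(1) rL(2) by auto
      have "L * e \<le> L * (1 / (2 * (L + 1)))" unfolding e_def using rL(2) by (intro mult_left_mono) auto
      also have "\<dots> \<le> 1 / 2" using rL(2) by (simp add: field_simps)
      finally show "L * e \<le> 1 / 2" .
    qed
    let ?I = "{0..T} \<inter> cball t e"
    have aW: "a s \<in> W" and bW: "b s \<in> W" if "s \<in> ?I" for s
      using e1(2)[of s] e2(2)[of s] that e by (auto simp: dist_commute)
    have "cmap c (a s) - cmap c (b s) = 0" if "s \<in> ?I" for s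
    proof (rule Lipschitz_ode_zero[of ?I t L "\<lambda>s. cmap c (a s) - cmap c (b s)"
          "\<lambda>s. \<xi> c (a s) - \<xi> c (b s)"])
      show "L * \<bar>s - t\<bar> \<le> 1 / 2" if "s \<in> ?I" for s
      proof -
        have "\<bar>s - t\<bar> \<le> e" using that by (auto simp: dist_real_def)
        from mult_left_mono[OF this rL(2)] show ?thesis using e(4) by linarith
      qed
      show "((\<lambda>s. cmap c (a s) - cmap c (b s)) has_vector_derivative \<xi> c (a s) - \<xi> c (b s)) (at s within ?I)"
        if s: "s \<in> ?I" for s
      proof (rule has_vector_derivative_within_subset[of _ _ _ "{0..T}"])
        show "((\<lambda>s. cmap c (a s) - cmap c (b s)) has_vector_derivative \<xi> c (a s) - \<xi> c (b s)) (at s within {0..T})"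
          using a b c(1) s aW[OF s] bW[OF s] unfolding integral_curve_on_def W_def
          by (intro has_vector_derivative_diff) auto
      qed auto
      show "norm (\<xi> c (a s) - \<xi> c (b s)) \<le> L * norm (cmap c (a s) - cmap c (b s))" if s: "s \<in> ?I" for s
        using rL(3)[of "cmap c (a s)" "cmap c (b s)"] aW[OF s] bW[OF s] inj unfolding W_def by simp
    qed (use t e(1) rL(2) True that in \<open>auto intro: convex_Int compact_Int\<close>)
    then have "a s = b s" if "s \<in> ?I" for s
      using aW[OF that] bW[OF that] inj that unfolding W_def by (auto dest: inj_onD)
    then show ?thesis using e(1) by (intro exI[of _ e]) (auto simp: dist_commute)
  qed
qed

section \<open>Flows\<close>

locale differentiable_flow =
  fixes A :: "('n::{t2_space,second_countable_topology}, 'p::finite) chart set"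
    and \<xi> :: "('n, 'p) vfield" and \<phi> :: "real \<Rightarrow> 'n \<Rightarrow> 'n"
  assumes atlas: "smooth_atlas A" and field: "Ck_field 2 A \<xi>" and flow: "is_flow A \<xi> \<phi>"
begin

lemma family: "Ck_family 2 {0..} A A \<phi>"
  using flow unfolding is_flow_def by blast

lemma flow_0: "\<phi> 0 x = x"
  using flow unfolding is_flow_def by blast

lemma flow_continuous: "continuous_on {0..} (\<lambda>t. \<phi> t x)"
  by (rule Ck_family_continuous[OF family]) (auto intro: continuous_intros)

lemma flow_derivative:
  assumes "t \<ge> 0" "c \<in> A" "\<phi> t x \<in> cdom c"
  shows "((\<lambda>s. cmap c (\<phi> s x)) has_vector_derivative \<xi> c (\<phi> t x)) (at t within {0..})"
  using assms flow unfolding is_flow_def by blast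

lemma integral_curve_flow:
  assumes "s \<ge> 0"
  shows "integral_curve_on A \<xi> {0..T} (\<lambda>t. \<phi> (t + s) x)"
  unfolding integral_curve_on_def
proof (intro conjI ballI impI)
  show "continuous_on {0..T} (\<lambda>t. \<phi> (t + s) x)"
    by (rule continuous_on_compose2[OF flow_continuous]) (use assms in \<open>auto intro!: continuous_intros\<close>)
  fix t c assume t: "t \<in> {0..T}" and c: "c \<in> A" "\<phi> (t + s) x \<in> cdom c"
  have "((\<lambda>t. t + s) has_vector_derivative 1) (at t within {0..T})"
    by (auto intro!: derivative_eq_intros)
  moreover have "((\<lambda>t. cmap c (\<phi> t x)) has_vector_derivative \<xi> c (\<phi> (t + s) x))
      (at (t + s) within (\<lambda>t. t + s) ` {0..T})"
    by (rule has_vector_derivative_within_subset[OF flow_derivative]) (use t c assms in auto)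
  ultimately show "((\<lambda>t. cmap c (\<phi> (t + s) x)) has_vector_derivative \<xi> c (\<phi> (t + s) x)) (at t within {0..T})"
    using vector_diff_chain_within by (fastforce simp: o_def)
qed

lemma flow_add:
  assumes "s \<ge> 0" "t \<ge> 0"
  shows "\<phi> (t + s) x = \<phi> t (\<phi> s x)"
proof (rule integral_curve_unique[OF atlas _ integral_curve_flow[OF assms(1)], of 1 t _ 0])
  show "Ck_field (Suc 1) A \<xi>" using field by (simp add: numeral_2_eq_2)
  show "integral_curve_on A \<xi> {0..t} (\<lambda>t. \<phi> t (\<phi> s x))"
    using integral_curve_flow[of 0 t "\<phi> s x"] by simp
qed (use assms in \<open>auto simp: flow_0\<close>)

lemma flow_inj:
  assumes "t \<ge> 0"
  shows "inj (\<phi> t)"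
proof (rule injI)
  fix x y assume eq: "\<phi> t x = \<phi> t y"
  have ic: "integral_curve_on A \<xi> {0..t} (\<lambda>t. \<phi> t z)" for z
    using integral_curve_flow[of 0 t z] by simp
  have "Ck_field (Suc 1) A \<xi>" using field by (simp add: numeral_2_eq_2)
  from integral_curve_unique[OF atlas this ic ic _ eq, of 0] show "x = y"
    using assms by (simp add: flow_0)
qed

lemma C2_at_flow:
  assumes "t \<ge> 0" "c \<in> A" "c' \<in> A" "x \<in> cdom c" "\<phi> t x \<in> cdom c'"
  shows "C2_at c c' (\<phi> t) x"
  using C2_at_family[OF atlas assms(2) atlas assms(3) family, of t x] assms by simp

lemma transition_det:
  assumes "c \<in> A" "c' \<in> A" "x \<in> cdom c" "x \<in> cdom c'"
  shows "det (matrix (D1 (local_rep c c' id) (cmap c x))) \<noteq> 0"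
proof -
  have "D1 (local_rep c c id) (cmap c x) = D1 id (cmap c x)"
    by (rule D1_cong[OF smooth_atlasD(2)[OF atlas assms(1)]])
      (use assms(3) in \<open>auto simp: local_rep_def f_inv_into_f\<close>)
  also have "\<dots> = id" by (rule D1_eqI) (simp add: has_derivative_ident id_def)
  finally have id: "D1 (local_rep c c id) (cmap c x) = id" .
  have i: "C2_at c' c id (id x)" using C2_at_id[OF atlas assms(2,1,4,3)] by simp
  have "matrix (D1 (local_rep c' c id) (cmap c' x)) ** matrix (D1 (local_rep c c' id) (cmap c x)) = mat 1"
    using C2_at_compose_matrix[OF C2_at_id[OF atlas assms] i] id
    unfolding id_def o_def by (simp add: matrix_id_mat_1[unfolded id_def])
  then show ?thesis
    by (metis det_I det_mul mult_eq_0_iff zero_neq_one)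
qed

abbreviation flow_matrix :: "('n, 'p) chart \<Rightarrow> ('n, 'p) chart \<Rightarrow> real \<Rightarrow> 'n \<Rightarrow> real^'p^'p" where
  "flow_matrix c c' t x \<equiv> matrix (D1 (local_rep c c' (\<phi> t)) (cmap c x))"

lemma flow_matrix_add:
  assumes "s \<ge> 0" "t \<ge> 0" "c0 \<in> A" "c1 \<in> A" "c2 \<in> A"
    and "x \<in> cdom c0" "\<phi> s x \<in> cdom c1" "\<phi> (t + s) x \<in> cdom c2"
  shows "flow_matrix c0 c2 (t + s) x = flow_matrix c1 c2 t (\<phi> s x) ** flow_matrix c0 c1 s x"
proof -
  have "\<phi> (t + s) = \<phi> t \<circ> \<phi> s" using flow_add[OF assms(1,2)] by auto
  then show ?thesis
    using C2_at_compose_matrix[OF C2_at_flow[of s c0 c1 x] C2_at_flow[of t c1 c2 "\<phi> s x"]] assms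
    by simp
qed

lemma flow_matrix_change_target:
  assumes "t \<ge> 0" "c0 \<in> A" "c1 \<in> A" "c2 \<in> A" "x \<in> cdom c0" "\<phi> t x \<in> cdom c1" "\<phi> t x \<in> cdom c2"
  shows "flow_matrix c0 c2 t x = matrix (transition_D1 c1 c2 (\<phi> t x)) ** flow_matrix c0 c1 t x"
  using C2_at_compose_matrix[OF C2_at_flow[of t c0 c1 x] C2_at_id[OF atlas, of c1 c2 "\<phi> t x"]] assms
  by (simp add: transition_local_rep_id id_def o_def)

lemma flow_matrix_continuous:
  assumes "c \<in> A" "c' \<in> A" "continuous_on Q p" "\<And>q. q \<in> Q \<Longrightarrow> p q \<ge> 0"
    "continuous_on Q x" "\<And>q. q \<in> Q \<Longrightarrow> x q \<in> cdom c" "\<And>q. q \<in> Q \<Longrightarrow> \<phi> (p q) (x q) \<in> cdom c'"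
  shows "continuous_on Q (\<lambda>q. flow_matrix c c' (p q) (x q) $ i $ j)"
proof -
  have "continuous_on Q (\<lambda>q. D1 (local_rep c c' (\<phi> (p q))) (cmap c (x q)) (axis j 1))"
    by (rule Ck_family_continuous_derivatives(1)[OF atlas assms(1) atlas assms(2) family assms(3)])
      (use assms in auto)
  then show ?thesis by (simp add: matrix_def continuous_on_component)
qed

text \<open>
  For small times the differential of the flow is close to the identity. By the semigroup property
  the determinants at two nearby times differ by such a factor, so the set of times at which the
  differential is invertible is open and closed.
\<close>

lemma flow_matrix_det:
  assumes "T \<ge> 0" "c \<in> A" "c' \<in> A" "x \<in> cdom c" "\<phi> T x \<in> cdom c'"
  shows "det (flow_matrix c c' T x) \<noteq> 0"
proof -
  define P where "P t \<longleftrightarrow> (\<forall>c'\<in>A. \<phi> t x \<in> cdom c' \<longrightarrow> det (flow_matrix c c' t x) \<noteq> 0)" for t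
  \<comment> \<open>a change of the target chart multiplies by an invertible matrix\<close>
  have P_chart: "P t \<longleftrightarrow> det (flow_matrix c c1 t x) \<noteq> 0" if "t \<ge> 0" "c1 \<in> A" "\<phi> t x \<in> cdom c1" for t c1
  proof
    assume "det (flow_matrix c c1 t x) \<noteq> 0"
    then show "P t"
      unfolding P_def using flow_matrix_change_target[OF that(1) assms(2) that(2) _ assms(4) that(3)]
        transition_det[OF that(2) _ that(3)]
      by (simp add: det_mul transition_local_rep_id)
  qed (use that in \<open>simp add: P_def\<close>)
  have "P T"
  proof (rule interval_local_induction[of 0 T])
    have "\<phi> 0 = id" using flow_0 by auto
    then show "P 0" using transition_det[OF assms(2) _ assms(4)] by (simp add: P_def)
    fix t assume t: "t \<in> {0..T}"
    define c1 where "c1 = chart_at A (\<phi> t x)"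
    have c1: "c1 \<in> A" "\<phi> t x \<in> cdom c1" unfolding c1_def using chart_at[OF atlas] by auto
    \<comment> \<open>\<open>d (s, s')\<close> is the factor by which the determinant changes between the times \<open>s \<le> s'\<close>\<close>
    define Q where "Q = {q::real \<times> real. 0 \<le> fst q \<and> fst q \<le> snd q \<and> \<phi> (fst q) x \<in> cdom c1 \<and> \<phi> (snd q) x \<in> cdom c1}"
    define d where "d q = det (flow_matrix c1 c1 (snd q - fst q) (\<phi> (fst q) x))" for q
    have flowQ: "\<phi> (snd q - fst q) (\<phi> (fst q) x) = \<phi> (snd q) x" if "q \<in> Q" for q
      using flow_add[of "fst q" "snd q - fst q" x] that unfolding Q_def by simp
    have "continuous_on Q (\<lambda>q. \<phi> (fst q) x)"
      by (rule continuous_on_compose2[OF flow_continuous]) (auto intro!: continuous_intros simp: Q_def)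
    then have "continuous_on Q d"
      unfolding d_def by (intro continuous_on_det flow_matrix_continuous c1 continuous_intros)
        (use flowQ in \<open>auto simp: Q_def\<close>)
    moreover have "\<phi> 0 = id" using flow_0 by auto
    then have "d (t, t) \<in> - {0}" using transition_det[OF c1(1,1,2,2)] by (simp add: d_def)
    moreover have "(t, t) \<in> Q" using t c1 by (simp add: Q_def)
    ultimately obtain e1 where e1: "e1 > 0" "\<And>q. q \<in> Q \<Longrightarrow> dist q (t, t) < e1 \<Longrightarrow> d q \<in> - {0}"
      using continuous_on_ball_in_open[of Q d "- {0}" "(t, t)"] by (metis open_Compl closed_singleton)
    obtain e2 where e2: "e2 > 0" "\<And>s. s \<in> {0..} \<Longrightarrow> dist s t < e2 \<Longrightarrow> \<phi> s x \<in> cdom c1"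
      using continuous_on_ball_in_open[OF flow_continuous smooth_atlasD(1)[OF atlas c1(1)] _ c1(2)] t by auto
    define e where "e = min (e1 / 2) e2"
    have iff: "P s \<longleftrightarrow> P s'" if "0 \<le> s" "s \<le> s'" "dist s t < e" "dist s' t < e" for s s'
    proof -
      have in_c1: "\<phi> s x \<in> cdom c1" "\<phi> s' x \<in> cdom c1" using e2(2) that unfolding e_def by auto
      have "dist (s, s') (t, t) \<le> dist s t + dist s' t"
        by (simp add: dist_Pair_Pair sqrt_sum_squares_le_sum)
      then have "d (s, s') \<noteq> 0"
        using e1(2)[of "(s, s')"] that in_c1 unfolding Q_def e_def by auto
      moreover have "flow_matrix c c1 s' x = flow_matrix c1 c1 (s' - s) (\<phi> s x) ** flow_matrix c c1 s x"
        using flow_matrix_add[of s "s' - s" c c1 c1 x] that assms c1 in_c1 by simp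
      ultimately show ?thesis
        using P_chart[OF _ c1(1)] in_c1 that by (simp add: d_def det_mul)
    qed
    have iff': "P s \<longleftrightarrow> P s'" if "0 \<le> s" "0 \<le> s'" "dist s t < e" "dist s' t < e" for s s'
      using iff[of s s'] iff[of s' s] that by linarith
    have "e > 0" using e1(1) e2(1) by (simp add: e_def)
    then show "\<exists>e>0. \<forall>r\<in>{0..T}. \<forall>s\<in>{0..T}. dist r t < e \<longrightarrow> dist s t < e \<longrightarrow> P r \<longrightarrow> P s"
    proof (intro exI[of _ e] conjI ballI impI)
      fix r s assume "r \<in> {0..T}" "s \<in> {0..T}" "dist r t < e" "dist s t < e" "P r"
      then show "P s" using iff'[of r s] by simp
    qed
  qed (use assms(1) in auto)
  then show ?thesis using P_chart[OF assms(1,3,5)] by blast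
qed

text \<open>
  In charts \<open>inv (\<phi> t)\<close> is a left inverse of the continuous map \<open>\<phi> t\<close> on an open set, which by the
  strong form of the inverse function theorem suffices for its differentiability at \<open>\<phi> t x\<close>.
\<close>

lemma inverse_flow_matrix:
  assumes "t \<ge> 0" "c \<in> A" "c' \<in> A" "x \<in> cdom c" "\<phi> t x \<in> cdom c'"
  shows "matrix (D1 (local_rep c' c (inv (\<phi> t))) (cmap c' (\<phi> t x))) = matrix_inv (flow_matrix c c' t x)"
proof -
  note C2 = C2_at_flow[OF assms]
  obtain U where U: "open U" "cmap c x \<in> U" "U \<subseteq> cimg c" "Ck_on 2 (local_rep c c' (\<phi> t)) U"
      "\<And>y. y \<in> U \<Longrightarrow> \<phi> t (cinv c y) \<in> cdom c'"
    using C2 unfolding C2_at_def by blast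
  let ?f = "local_rep c c' (\<phi> t)" and ?g = "local_rep c' c (inv (\<phi> t))"
  have "?g (?f y) = y" if "y \<in> U" for y
    using U(5)[OF that] smooth_atlasD(3)[OF atlas assms(3)] U(3) that flow_inj[OF assms(1)]
    by (auto simp: local_rep_def f_inv_into_f)
  moreover have "D1 ?f (cmap c x) = (*v) (flow_matrix c c' t x)"
    using C2_at_linear[OF C2] by (simp add: fun_eq_iff matrix_works)
  then have "D1 ?f (cmap c x) \<circ> (*v) (matrix_inv (flow_matrix c c' t x)) = id"
    using matrix_inv_inverse(1)[OF flow_matrix_det[OF assms]]
    by (auto simp: fun_eq_iff matrix_vector_mul_assoc)
  ultimately have "(?g has_derivative (*v) (matrix_inv (flow_matrix c c' t x))) (at (?f (cmap c x)))"
    by (intro has_derivative_inverse_strong[OF U(1,2) Ck_on_continuous[OF U(4)]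
          _ C2_at_has_derivative[OF C2]]) auto
  then show ?thesis
    using D1_eqI by (fastforce simp: C2_at_local_rep[OF C2])
qed

end

section \<open>The tensor pulled back along a trajectory\<close>

context differentiable_flow
begin

text \<open>The integrand of \<open>\<Pi>\<close>, hence its rate of change (\<open>tensor_rate_Pi\<close> below).\<close>

abbreviation pulled_back :: "('n, 'p) mfield \<Rightarrow> 'n \<Rightarrow> ('n, 'p) chart \<Rightarrow> real \<Rightarrow> real^'p^'p" where
  "pulled_back \<alpha> x c t \<equiv> push2 A (inv (\<phi> t)) (\<phi> t x) (\<lambda>c'. \<alpha> c' (\<phi> t x)) c"

text \<open>
  \<open>(\<phi>\<^sub>t)\<^sub>* (\<phi>\<^sub>-\<^sub>t)\<^sub>* \<alpha> = \<alpha>\<close>, where the push-forward may be computed in any chart at \<open>\<phi>\<^sub>t(x)\<close>. This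
  characterises the pulled back tensor without reference to the chosen chart at that point.
\<close>

lemma push_pulled_back:
  assumes \<alpha>: "tensor_field A \<alpha>" and t: "t \<ge> 0" and c: "c0 \<in> A" "c1 \<in> A" "x \<in> cdom c0" "\<phi> t x \<in> cdom c1"
  shows "flow_matrix c0 c1 t x ** pulled_back \<alpha> x c0 t ** transpose (flow_matrix c0 c1 t x) = \<alpha> c1 (\<phi> t x)"
proof -
  define c where "c = chart_at A (\<phi> t x)"
  have c': "c \<in> A" "\<phi> t x \<in> cdom c" unfolding c_def using chart_at[OF atlas] by auto
  define L where "L = flow_matrix c0 c t x"
  define J where "J = matrix (transition_D1 c c1 (\<phi> t x))"
  have inv: "L ** matrix_inv L = mat 1"
    unfolding L_def by (rule matrix_inv_inverse(1)[OF flow_matrix_det]) (use t c c' in auto)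
  have "pulled_back \<alpha> x c0 t = matrix_inv L ** \<alpha> c (\<phi> t x) ** transpose (matrix_inv L)"
    using inverse_flow_matrix[OF t c(1) c'(1) c(3) c'(2)]
    by (simp add: push2_def Let_def c_def[symmetric] L_def)
  moreover have "flow_matrix c0 c1 t x = J ** L"
    unfolding J_def L_def by (rule flow_matrix_change_target) (use t c c' in auto)
  ultimately have "flow_matrix c0 c1 t x ** pulled_back \<alpha> x c0 t ** transpose (flow_matrix c0 c1 t x) =
      (J ** (L ** matrix_inv L)) ** \<alpha> c (\<phi> t x) ** transpose (J ** (L ** matrix_inv L))"
    by (simp add: matrix_transpose_mul matrix_mul_assoc)
  also have "\<dots> = J ** \<alpha> c (\<phi> t x) ** transpose J" unfolding inv by simp
  also have "\<dots> = \<alpha> c1 (\<phi> t x)"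
    using \<alpha>[unfolded tensor_field_def Let_def, rule_format, OF c'(1) c(2), of "\<phi> t x"] c'(2) c(4)
    unfolding J_def by simp
  finally show ?thesis .
qed

lemma pulled_back_continuous:
  assumes \<alpha>: "tensor_field A \<alpha>" "\<And>c. c \<in> A \<Longrightarrow> continuous_on (cdom c) (\<alpha> c)"
    and c0: "c0 \<in> A" "x \<in> cdom c0"
  shows "continuous_on {0..} (pulled_back \<alpha> x c0)"
proof (rule continuous_on_locally)
  fix t :: real assume t: "t \<in> {0..}"
  define c where "c = chart_at A (\<phi> t x)"
  have c: "c \<in> A" "\<phi> t x \<in> cdom c" unfolding c_def using chart_at[OF atlas] by auto
  obtain e where e: "e > 0" "\<And>s. s \<in> {0..} \<Longrightarrow> dist s t < e \<Longrightarrow> \<phi> s x \<in> cdom c"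
    using continuous_on_ball_in_open[OF flow_continuous smooth_atlasD(1)[OF atlas c(1)] t c(2)] by blast
  define R where "R = {0..} \<inter> ball t e"
  have R: "s \<ge> 0" "\<phi> s x \<in> cdom c" if "s \<in> R" for s
    using e(2)[of s] that unfolding R_def by (auto simp: dist_commute)
  have inv: "matrix_inv (flow_matrix c0 c s x) ** flow_matrix c0 c s x = mat 1" if "s \<in> R" for s
    by (rule matrix_inv_inverse(2)[OF flow_matrix_det]) (use R[OF that] c c0 in auto)
  have "continuous_on R (\<lambda>s. flow_matrix c0 c s x $ i $ j)" for i j
    by (rule flow_matrix_continuous) (use R c c0 in \<open>auto intro!: continuous_intros\<close>)
  then have K: "continuous_on R (\<lambda>s. matrix_inv (flow_matrix c0 c s x) $ i $ j)" for i j
    by (rule continuous_on_matrix_inv) (use flow_matrix_det R c c0 in blast)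
  have "continuous_on R (\<lambda>s. \<phi> s x)"
    by (rule continuous_on_subset[OF flow_continuous]) (use R in auto)
  then have "continuous_on R (\<lambda>s. \<alpha> c (\<phi> s x))"
    by (rule continuous_on_compose2[OF \<alpha>(2)[OF c(1)]]) (use R in auto)
  then have \<alpha>R: "continuous_on R (\<lambda>s. \<alpha> c (\<phi> s x) $ i $ j)" for i j
    by (rule continuous_on_component2)
  have "continuous_on R (\<lambda>s. matrix_inv (flow_matrix c0 c s x) ** \<alpha> c (\<phi> s x) **
      transpose (matrix_inv (flow_matrix c0 c s x)))"
    unfolding matrix_matrix_mult_def transpose_def
    by (auto intro!: continuous_on_vec_lambda continuous_on_sum continuous_on_mult K \<alpha>R)
  moreover have "matrix_inv (flow_matrix c0 c s x) ** \<alpha> c (\<phi> s x) **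
      transpose (matrix_inv (flow_matrix c0 c s x)) = pulled_back \<alpha> x c0 s" if s: "s \<in> R" for s
  proof -
    let ?L = "flow_matrix c0 c s x" and ?M = "pulled_back \<alpha> x c0 s"
    have "matrix_inv ?L ** (?L ** ?M ** transpose ?L) ** transpose (matrix_inv ?L) =
        (matrix_inv ?L ** ?L) ** ?M ** transpose (matrix_inv ?L ** ?L)"
      by (simp only: matrix_transpose_mul matrix_mul_assoc)
    also have "\<dots> = ?M" unfolding inv[OF s] by simp
    finally show ?thesis
      using push_pulled_back[OF \<alpha>(1) R(1)[OF s] c0(1) c(1) c0(2) R(2)[OF s]] by simp
  qed
  ultimately have "continuous_on R (pulled_back \<alpha> x c0)" by (rule continuous_on_eq)
  then show "\<exists>W. open W \<and> t \<in> W \<and> continuous_on ({0..} \<inter> W) (pulled_back \<alpha> x c0)"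
    unfolding R_def using e(1) by (intro exI[of _ "ball t e"]) auto
qed

lemma tensor_rate_Pi:
  assumes \<alpha>: "tensor_field A \<alpha>" "\<And>c. c \<in> A \<Longrightarrow> continuous_on (cdom c) (\<alpha> c)"
    and c0: "c0 \<in> A" "x \<in> cdom c0" and t: "t \<ge> 0"
  shows "tensor_rate (Pi_tensor A \<alpha> \<phi> x) t c0 = pulled_back \<alpha> x c0 t"
proof -
  have "continuous_on {0..t + 1} (pulled_back \<alpha> x c0)"
    by (rule continuous_on_subset[OF pulled_back_continuous[OF \<alpha> c0]]) auto
  then have "((\<lambda>s. integral {0..s} (pulled_back \<alpha> x c0)) has_vector_derivative pulled_back \<alpha> x c0 t)
      (at t within {0..t + 1})"
    by (rule integral_has_vector_derivative) (use t in auto)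
  moreover have "at t within {0..t + 1} = at t within {0..}"
    by (rule at_within_nhd[of _ "{..<t + 1}"]) auto
  moreover have "at t within {0..t + 1} \<noteq> bot"
    using t by (simp add: trivial_limit_within)
  ultimately show ?thesis
    unfolding tensor_rate_def Pi_tensor_def by (simp add: vector_derivative_within)
qed

text \<open>
  The second fundamental form of \<open>\<phi>\<^sub>\<delta> = \<phi>\<^sub>\<delta>\<^sub>-\<^sub>t \<circ> \<phi>\<^sub>t\<close>, solved for the contribution of the later
  piece \<open>\<phi>\<^sub>\<delta>\<^sub>-\<^sub>t\<close>.
\<close>

lemma second_fund_form_flow_split:
  assumes \<Gamma>: "is_connection A \<Gamma>"
    and \<alpha>: "tensor_field A \<alpha>" "\<And>c. c \<in> A \<Longrightarrow> continuous_on (cdom c) (\<alpha> c)"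
    and t: "0 \<le> t" "t \<le> \<delta>" and c: "c \<in> A" "\<phi> \<delta> x \<in> cdom c"
  shows "push A (\<phi> (\<delta> - t)) (\<phi> t x)
      (second_fund_form A \<Gamma> \<Gamma> (\<phi> t) x (tensor_rate (Pi_tensor A \<alpha> \<phi> x) t)) c =
    sff_chart \<Gamma> \<Gamma> (chart_at A x) c (\<phi> \<delta>) x (pulled_back \<alpha> x (chart_at A x) t) -
    second_fund_form A \<Gamma> \<Gamma> (\<phi> (\<delta> - t)) (\<phi> t x) (\<lambda>c. \<alpha> c (\<phi> t x)) c"
proof -
  let ?c0 = "chart_at A x" and ?c1 = "chart_at A (\<phi> t x)"
  note c0 = chart_at[OF atlas, of x] and c1 = chart_at[OF atlas, of "\<phi> t x"]
  have comp: "\<phi> (\<delta> - t) \<circ> \<phi> t = \<phi> \<delta>" using flow_add[of t "\<delta> - t"] t by auto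
  then have target: "\<phi> (\<delta> - t) (\<phi> t x) = \<phi> \<delta> x" by (metis comp_apply)
  have f: "C2_at ?c0 ?c1 (\<phi> t) x" by (rule C2_at_flow) (use t c0 c1 in auto)
  have g: "C2_at ?c1 c (\<phi> (\<delta> - t)) (\<phi> t x)" by (rule C2_at_flow) (use t c c1 target in auto)
  show ?thesis
    using sff_chart_compose[OF f g, of \<Gamma> \<Gamma> "pulled_back \<alpha> x ?c0 t" \<Gamma>]
    unfolding comp push_pulled_back[OF \<alpha>(1) t(1) c0(1) c1(1) c0(2) c1(2)]
    by (simp add: push_def Let_def second_fund_form_sff_chart tensor_rate_Pi[OF \<alpha> c0 t(1)])
qed

end

section \<open>Transport along the flow\<close>

text \<open>
  The chain rule for a curve that may run in the boundary of \<open>S\<close>, where \<open>f\<close> is differentiable within \<open>S\<close>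
  only: at \<open>\<gamma> = 0\<close> or at the end points of the time interval the derivatives of \<open>u\<^sup>\<gamma>\<close> are one-sided.
\<close>

lemma has_vector_derivative_along:
  assumes f: "(f has_derivative D) (at (\<kappa> s) within S)" and \<kappa>: "(\<kappa> has_vector_derivative k) (at s within I)"
    and s: "s \<in> I" and e: "e > 0" "\<And>r. r \<in> I \<Longrightarrow> dist r s < e \<Longrightarrow> \<kappa> r \<in> S"
    and g: "\<And>r. r \<in> I \<Longrightarrow> dist r s < e \<Longrightarrow> f (\<kappa> r) = g r"
  shows "(g has_vector_derivative D k) (at s within I)"
proof -
  let ?J = "I \<inter> ball s e"
  have J: "at s within ?J = at s within I"
    by (rule at_within_nhd[of _ "ball s e"]) (use e(1) in auto)
  have "(\<kappa> has_derivative (\<lambda>h. h *\<^sub>R k)) (at s within ?J)"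
    using \<kappa> unfolding J has_vector_derivative_def .
  moreover have "(f has_derivative D) (at (\<kappa> s) within \<kappa> ` ?J)"
    by (rule has_derivative_subset[OF f]) (use e(2) in \<open>auto simp: dist_commute\<close>)
  ultimately have "((\<lambda>r. f (\<kappa> r)) has_derivative (\<lambda>h. D (h *\<^sub>R k))) (at s within ?J)"
    by (rule has_derivative_in_compose)
  then have "(g has_derivative (\<lambda>h. D (h *\<^sub>R k))) (at s within ?J)"
    by (rule has_derivative_transform[rotated 2]) (use s e(1) g in \<open>auto simp: dist_commute\<close>)
  then show ?thesis
    unfolding J has_vector_derivative_def
    using linear_cmul[OF has_derivative_linear[OF f]] by simp
qed

text \<open>
  Along a trajectory of \<open>\<xi>\<close>, run backwards in step with the time of \<open>u\<^sup>\<gamma>\<close>, the first order term of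
  the equation is exactly the change of the base point, and only the second order term remains.
\<close>

lemma (in differentiable_flow) transport_derivative:
  fixes B :: "('m::{t2_space,second_countable_topology}, 'q::finite) chart set"
  assumes B: "smooth_atlas B" and u: "pde_solution A B \<Gamma> \<Gamma>' \<xi> \<alpha> \<psi> \<gamma>1 \<delta>1 u"
    and \<gamma>: "\<gamma> \<in> {0..\<gamma>1}" and \<delta>: "\<delta> \<le> \<delta>1" "\<delta>1 > 0" and s: "s \<in> {0..\<delta>}"
    and c: "c \<in> B" "u \<gamma> s (\<phi> (\<delta> - s) x) \<in> cdom c"
  shows "((\<lambda>s. cmap c (u \<gamma> s (\<phi> (\<delta> - s) x))) has_vector_derivative
    (\<gamma> / 2) *\<^sub>R second_fund_form A \<Gamma> \<Gamma>' (u \<gamma> s) (\<phi> (\<delta> - s) x) (\<lambda>c. \<alpha> c (\<phi> (\<delta> - s) x)) c)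
    (at s within {0..\<delta>})"
proof -
  define X where "X = \<phi> (\<delta> - s) x"
  define c1 where "c1 = chart_at A X"
  have c1: "c1 \<in> A" "X \<in> cdom c1" unfolding c1_def using chart_at[OF atlas] by auto
  note inj1 = smooth_atlasD(3)[OF atlas c1(1)]
  let ?F = "\<lambda>(\<gamma>, t). u \<gamma> t" and ?R = "{0..\<gamma>1} \<times> {0..\<delta>1}"
  let ?f = "\<lambda>(r, y). cmap c (?F r (cinv c1 y))" and ?S = "family_dom ?R ?F c1 c"
  have fam: "Ck_family 2 ?R A B ?F" using u unfolding pde_solution_def by blast
  define p where "p = ((\<gamma>, s), cmap c1 X)"
  have pS: "p \<in> ?S" using \<gamma> s \<delta> c c1 inj1 by (simp add: p_def X_def)
  have "Ck_on (Suc (Suc 0)) ?f ?S"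
    using fam c1(1) c(1) unfolding Ck_family_def numeral_2_eq_2 by blast
  then have diff: "?f differentiable (at p within ?S)" using pS unfolding Ck_on.simps(2) by blast
  define D where "D = frechet_derivative ?f (at p within ?S)"
  have D: "(?f has_derivative D) (at p within ?S)"
    using diff unfolding D_def by (simp add: frechet_derivative_works)
  then have lin: "linear D" by (rule has_derivative_linear)
  have D_space: "D (0, v) = D1 (local_rep c1 c (u \<gamma> s)) (cmap c1 X) v" for v
    using D1_fibre(2)[OF Ck_family_fibre_open[OF atlas c1(1) B c(1) fam], of "(\<gamma>, s)" "cmap c1 X" ?f v]
      pS diff
    unfolding p_def[symmetric] D_def[symmetric] by (simp add: local_rep_def o_def)
  \<comment> \<open>the equation determines the partial derivative in time at a fixed point \<open>X\<close>\<close>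
  have D_time: "D ((0, 1), 0) = push A (u \<gamma> s) X (\<lambda>c'. \<xi> c' X) c +
      (\<gamma> / 2) *\<^sub>R second_fund_form A \<Gamma> \<Gamma>' (u \<gamma> s) X (\<lambda>c'. \<alpha> c' X) c" (is "_ = ?rhs")
  proof -
    have s1: "s \<in> {0..\<delta>1}" using s \<delta> by auto
    have "continuous_on {0..\<delta>1} (\<lambda>r. ?F (\<gamma>, r) X)"
      by (rule Ck_family_continuous[OF fam]) (use \<gamma> in \<open>auto intro!: continuous_intros\<close>)
    then have "continuous_on {0..\<delta>1} (\<lambda>r. u \<gamma> r X)" by simp
    from continuous_on_ball_in_open[OF this smooth_atlasD(1)[OF B c(1)] s1] c(2)
    obtain e where e: "e > 0" "\<And>r. r \<in> {0..\<delta>1} \<Longrightarrow> dist r s < e \<Longrightarrow> u \<gamma> r X \<in> cdom c"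
      unfolding X_def by blast
    have "((\<lambda>r. ((\<gamma>, r), cmap c1 X)) has_vector_derivative ((0, 1), 0)) (at s within {0..\<delta>1})"
      by (intro has_vector_derivative_Pair has_vector_derivative_const has_vector_derivative_id)
    then have "((\<lambda>r. cmap c (u \<gamma> r X)) has_vector_derivative D ((0, 1), 0)) (at s within {0..\<delta>1})"
    proof (rule has_vector_derivative_along[OF _ _ s1 e(1), of ?f D "\<lambda>r. ((\<gamma>, r), cmap c1 X)" ?S, rotated])
      show "(?f has_derivative D) (at ((\<gamma>, s), cmap c1 X) within ?S)"
        using D unfolding p_def .
    qed (use e(2) \<gamma> c1 inj1 in auto)
    moreover have "((\<lambda>r. cmap c (u \<gamma> r X)) has_vector_derivative ?rhs) (at s within {0..\<delta>1})"
      using u \<gamma> s1 c unfolding pde_solution_def X_def by blast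
    moreover have "at s within {0..\<delta>1} \<noteq> bot" using s1 \<delta>(2) by (simp add: trivial_limit_within)
    ultimately show ?thesis using vector_derivative_unique_within by blast
  qed
  have D_total: "D ((0, 1), - \<xi> c1 X) = (\<gamma> / 2) *\<^sub>R second_fund_form A \<Gamma> \<Gamma>' (u \<gamma> s) X (\<lambda>c'. \<alpha> c' X) c"
  proof -
    have "D ((0, 1), - \<xi> c1 X) = D ((0, 1), 0) + D (0, - \<xi> c1 X)"
      using linear_add[OF lin, of "((0, 1), 0)" "(0, - \<xi> c1 X)"] by simp
    also have "D (0, - \<xi> c1 X) = - D (0, \<xi> c1 X)"
      using linear_neg[OF lin, of "(0, \<xi> c1 X)"] by simp
    also have "D (0, \<xi> c1 X) = push A (u \<gamma> s) X (\<lambda>c'. \<xi> c' X) c"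
      by (simp add: D_space push_def Let_def c1_def)
    finally show ?thesis unfolding D_time by simp
  qed
  have reversed: "continuous_on {0..\<delta>} (\<lambda>r. \<phi> (\<delta> - r) x)"
    by (rule continuous_on_compose2[OF flow_continuous]) (auto intro!: continuous_intros)
  then have "continuous_on {0..\<delta>} (\<lambda>r. ?F (\<gamma>, r) (\<phi> (\<delta> - r) x))"
    by (intro Ck_family_continuous[OF fam]) (use \<gamma> \<delta> in \<open>auto intro!: continuous_intros\<close>)
  then have cont: "continuous_on {0..\<delta>} (\<lambda>r. u \<gamma> r (\<phi> (\<delta> - r) x))" by simp
  obtain e1 where e1: "e1 > 0" "\<And>r. r \<in> {0..\<delta>} \<Longrightarrow> dist r s < e1 \<Longrightarrow> u \<gamma> r (\<phi> (\<delta> - r) x) \<in> cdom c"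
    using continuous_on_ball_in_open[OF cont smooth_atlasD(1)[OF B c(1)] s c(2)] by blast
  obtain e2 where e2: "e2 > 0" "\<And>r. r \<in> {0..\<delta>} \<Longrightarrow> dist r s < e2 \<Longrightarrow> \<phi> (\<delta> - r) x \<in> cdom c1"
    using continuous_on_ball_in_open[OF reversed smooth_atlasD(1)[OF atlas c1(1)] s] c1(2)
    unfolding X_def by blast
  have "((\<lambda>r. \<delta> - r) has_vector_derivative - 1) (at s within {0..\<delta>})"
    by (auto intro!: derivative_eq_intros)
  moreover have "((\<lambda>t. cmap c1 (\<phi> t x)) has_vector_derivative \<xi> c1 X) (at (\<delta> - s) within (\<lambda>r. \<delta> - r) ` {0..\<delta>})"
  proof (rule has_vector_derivative_within_subset[of _ _ _ "{0..}"])
    show "((\<lambda>t. cmap c1 (\<phi> t x)) has_vector_derivative \<xi> c1 X) (at (\<delta> - s) within {0..})"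
      using flow_derivative[of "\<delta> - s" c1 x] s c1 unfolding X_def by simp
  qed auto
  ultimately have "((\<lambda>r. cmap c1 (\<phi> (\<delta> - r) x)) has_vector_derivative - \<xi> c1 X) (at s within {0..\<delta>})"
    using vector_diff_chain_within by (fastforce simp: o_def)
  then have "((\<lambda>r. ((\<gamma>, r), cmap c1 (\<phi> (\<delta> - r) x))) has_vector_derivative ((0, 1), - \<xi> c1 X)) (at s within {0..\<delta>})"
    by (intro has_vector_derivative_Pair has_vector_derivative_const has_vector_derivative_id)
  then have "((\<lambda>r. cmap c (u \<gamma> r (\<phi> (\<delta> - r) x))) has_vector_derivative D ((0, 1), - \<xi> c1 X)) (at s within {0..\<delta>})"
  proof (rule has_vector_derivative_along[OF _ _ s, of ?f D
        "\<lambda>r. ((\<gamma>, r), cmap c1 (\<phi> (\<delta> - r) x))" ?S _ "min e1 e2", rotated])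
    show "(?f has_derivative D) (at ((\<gamma>, s), cmap c1 (\<phi> (\<delta> - s) x)) within ?S)"
      using D unfolding p_def X_def .
  qed (use e1 e2 \<gamma> \<delta> inj1 in auto)
  then show ?thesis unfolding D_total unfolding X_def .
qed

lemma curve_constant:
  fixes B :: "('m::{t2_space,second_countable_topology}, 'q::finite) chart set"
  assumes B: "smooth_atlas B" and f: "continuous_on {0..T} f"
    and der: "\<And>t c. t \<in> {0..T} \<Longrightarrow> c \<in> B \<Longrightarrow> f t \<in> cdom c \<Longrightarrow>
      ((\<lambda>s. cmap c (f s)) has_vector_derivative 0) (at t within {0..T})"
    and t: "t \<in> {0..T}"
  shows "f t = f 0"
proof (rule interval_local_induction[where P = "\<lambda>t. f t = f 0" and s = 0 and T = T])
  fix t assume t: "t \<in> {0..T}"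
  define c where "c = chart_at B (f t)"
  have c: "c \<in> B" "f t \<in> cdom c" unfolding c_def using chart_at[OF B] by auto
  obtain e where e: "e > 0" "\<And>r. r \<in> {0..T} \<Longrightarrow> dist r t < e \<Longrightarrow> f r \<in> cdom c"
    using continuous_on_ball_in_open[OF f smooth_atlasD(1)[OF B c(1)] t c(2)] by blast
  let ?I = "{0..T} \<inter> ball t e"
  have fI: "f r \<in> cdom c" if "r \<in> ?I" for r using e(2)[of r] that by (auto simp: dist_commute)
  have "\<exists>k. \<forall>r\<in>?I. cmap c (f r) = k"
  proof (rule has_derivative_zero_constant)
    show "convex ?I" by (intro convex_Int) auto
    show "((\<lambda>r. cmap c (f r)) has_derivative (\<lambda>h. 0)) (at r within ?I)" if r: "r \<in> ?I" for r
    proof -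
      have "((\<lambda>r. cmap c (f r)) has_vector_derivative 0) (at r within {0..T})"
        using der[of r c] c(1) fI[OF r] r by blast
      then have "((\<lambda>r. cmap c (f r)) has_vector_derivative 0) (at r within ?I)"
        by (rule has_vector_derivative_within_subset) auto
      then show ?thesis by (simp add: has_vector_derivative_def)
    qed
  qed
  then have const: "f r = f r'" if "r \<in> ?I" "r' \<in> ?I" for r r'
    using fI[OF that(1)] fI[OF that(2)] smooth_atlasD(3)[OF B c(1)] that by (metis inj_onD)
  show "\<exists>e>0. \<forall>x\<in>{0..T}. \<forall>y\<in>{0..T}. dist x t < e \<longrightarrow> dist y t < e \<longrightarrow> f x = f 0 \<longrightarrow> f y = f 0"
  proof (intro exI[of _ e] conjI ballI impI e(1))
    fix x y assume "x \<in> {0..T}" "y \<in> {0..T}" "dist x t < e" "dist y t < e" "f x = f 0"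
    then show "f y = f 0" using const[of x y] by (simp add: dist_commute)
  qed
qed (use t in auto)

text \<open>
  For \<open>\<gamma> = 0\<close> the curve \<open>s \<mapsto> u\<^sup>0(s, \<phi>\<^sub>\<delta>\<^sub>-\<^sub>s(x))\<close> has zero derivative; it joins \<open>\<psi>(\<phi>\<^sub>\<delta>(x))\<close> to
  \<open>u\<^sup>0(\<delta>, x)\<close>.
\<close>

lemma (in differentiable_flow) unperturbed_solution:
  fixes B :: "('m::{t2_space,second_countable_topology}, 'q::finite) chart set"
  assumes B: "smooth_atlas B" and u: "pde_solution A B \<Gamma> \<Gamma>' \<xi> \<alpha> \<psi> \<gamma>1 \<delta>1 u"
    and "\<gamma>1 > 0" and \<delta>: "0 \<le> \<delta>" "\<delta> \<le> \<delta>1" "\<delta>1 > 0"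
  shows "u 0 \<delta> x = \<psi> (\<phi> \<delta> x)"
proof -
  have \<gamma>: "0 \<in> {0..\<gamma>1}" using assms(3) by simp
  have fam: "Ck_family 2 ({0..\<gamma>1} \<times> {0..\<delta>1}) A B (\<lambda>(\<gamma>, t). u \<gamma> t)"
    using u unfolding pde_solution_def by blast
  have "continuous_on {0..\<delta>} (\<lambda>r. \<phi> (\<delta> - r) x)"
    by (rule continuous_on_compose2[OF flow_continuous]) (auto intro!: continuous_intros)
  then have "continuous_on {0..\<delta>} (\<lambda>r. (\<lambda>(\<gamma>, t). u \<gamma> t) (0, r) (\<phi> (\<delta> - r) x))"
    by (intro Ck_family_continuous[OF fam]) (use \<gamma> \<delta> in \<open>auto intro!: continuous_intros\<close>)
  then have "continuous_on {0..\<delta>} (\<lambda>r. u 0 r (\<phi> (\<delta> - r) x))" by simp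
  from curve_constant[OF B this, of \<delta>] transport_derivative[OF B u \<gamma> \<delta>(2,3)] \<delta>(1)
  have "u 0 \<delta> (\<phi> (\<delta> - \<delta>) x) = u 0 0 (\<phi> (\<delta> - 0) x)" by simp
  then show ?thesis using u \<gamma> by (simp add: flow_0 pde_solution_def)
qed

section \<open>The derivative at \<open>\<gamma> = 0\<close>\<close>

text \<open>
  The fundamental theorem of calculus gives \<open>G \<gamma> \<delta> = a + (\<gamma>/2) I(\<gamma>)\<close> with a continuous function \<open>I\<close>,
  and the factor \<open>\<gamma>\<close> turns continuity of \<open>I\<close> at \<open>0\<close> into differentiability with derivative \<open>I(0)/2\<close>.
\<close>

lemma derivative_of_scaled_integral:
  fixes G J :: "real \<Rightarrow> real \<Rightarrow> 'a::banach"
  assumes \<epsilon>: "\<epsilon> > 0" and \<delta>: "\<delta> \<ge> 0"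
    and G: "\<And>\<gamma> s. \<gamma> \<in> {0..\<epsilon>} \<Longrightarrow> s \<in> {0..\<delta>} \<Longrightarrow>
      (G \<gamma> has_vector_derivative (\<gamma> / 2) *\<^sub>R J \<gamma> s) (at s within {0..\<delta>})"
    and G0: "\<And>\<gamma>. \<gamma> \<in> {0..\<epsilon>} \<Longrightarrow> G \<gamma> 0 = a"
    and J: "continuous_on ({0..\<epsilon>} \<times> {0..\<delta>}) (\<lambda>(\<gamma>, s). J \<gamma> s)"
  shows "((\<lambda>\<gamma>. G \<gamma> \<delta>) has_vector_derivative (1 / 2) *\<^sub>R integral {0..\<delta>} (J 0)) (at 0 within {0..\<epsilon>})"
proof -
  define I where "I \<gamma> = integral {0..\<delta>} (J \<gamma>)" for \<gamma>
  have "continuous_on {0..\<epsilon>} I"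
    unfolding I_def using integral_continuous_on_param[of "{0..\<epsilon>}" 0 \<delta> J] J by simp
  then have "(I \<longlongrightarrow> I 0) (at 0 within {0..\<epsilon>})"
    using \<epsilon> by (simp add: continuous_on_def)
  then have "((\<lambda>\<gamma>. norm (I \<gamma> - I 0) / 2) \<longlongrightarrow> norm (I 0 - I 0) / 2) (at 0 within {0..\<epsilon>})"
    by (intro tendsto_intros) auto
  then have lim: "((\<lambda>\<gamma>. norm (I \<gamma> - I 0) / 2) \<longlongrightarrow> 0) (at 0 within {0..\<epsilon>})" by simp
  have eq: "G \<gamma> \<delta> = a + (\<gamma> / 2) *\<^sub>R I \<gamma>" if \<gamma>: "\<gamma> \<in> {0..\<epsilon>}" for \<gamma>
  proof -
    have "((\<lambda>s. (\<gamma> / 2) *\<^sub>R J \<gamma> s) has_integral G \<gamma> \<delta> - G \<gamma> 0) {0..\<delta>}"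
      using fundamental_theorem_of_calculus[OF \<delta> G[OF \<gamma>]] by simp
    then have "G \<gamma> \<delta> - G \<gamma> 0 = (\<gamma> / 2) *\<^sub>R I \<gamma>"
      unfolding I_def integral_cmul[symmetric] by (rule integral_unique[symmetric])
    then show ?thesis using G0[OF \<gamma>] by (simp add: algebra_simps)
  qed
  have "((\<lambda>\<gamma>. a + (\<gamma> / 2) *\<^sub>R I \<gamma>) has_vector_derivative (1 / 2) *\<^sub>R I 0) (at 0 within {0..\<epsilon>})"
    unfolding has_vector_derivative_def has_derivative_within
  proof (intro conjI)
    show "bounded_linear (\<lambda>h. h *\<^sub>R (1 / 2) *\<^sub>R I 0)" by (rule bounded_linear_scaleR_left)
    show "((\<lambda>y. (1 / norm (y - 0)) *\<^sub>R (a + (y / 2) *\<^sub>R I y -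
        (a + (0 / 2) *\<^sub>R I 0 + (y - 0) *\<^sub>R (1 / 2) *\<^sub>R I 0))) \<longlongrightarrow> 0) (at 0 within {0..\<epsilon>})"
    proof (rule tendsto_norm_zero_cancel, rule Lim_transform_within[OF lim zero_less_one])
      fix y :: real assume "y \<in> {0..\<epsilon>}" "0 < dist y 0"
      then have y: "y > 0" by auto
      have "a + (y / 2) *\<^sub>R I y - (a + (0 / 2) *\<^sub>R I 0 + (y - 0) *\<^sub>R (1 / 2) *\<^sub>R I 0) = (y / 2) *\<^sub>R (I y - I 0)"
        by (simp add: algebra_simps)
      then show "norm (I y - I 0) / 2 = norm ((1 / norm (y - 0)) *\<^sub>R (a + (y / 2) *\<^sub>R I y -
        (a + (0 / 2) *\<^sub>R I 0 + (y - 0) *\<^sub>R (1 / 2) *\<^sub>R I 0)))"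
        using y by simp
    qed
  qed
  then show ?thesis
    unfolding I_def[symmetric]
    by (rule has_vector_derivative_transform[rotated 2]) (use \<epsilon> eq in auto)
qed

lemma integral_reversed:
  fixes f :: "real \<Rightarrow> 'a::euclidean_space"
  shows "integral {0..d} (\<lambda>s. f (d - s)) = integral {0..d} f"
proof -
  have "integral {0..d} (\<lambda>s. f (d - s)) = integral {- d..- 0} (\<lambda>s. f (d - - s))"
    using Henstock_Kurzweil_Integration.integral_reflect_real[of d 0 "\<lambda>s. f (d - s)"] by simp
  also have "\<dots> = integral {- d + d..- 0 + d} f"
    using integral_shift_real_ivl[of 0 d d f] by (simp add: add.commute)
  finally show ?thesis by simp
qed

lemma linear_congruence_transform: "linear (\<lambda>T. L ** T ** transpose L)"
  for L :: "real^'p::finite^'q::finite"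
  by (rule linearI)
    (simp_all add: vec_eq_iff matrix_matrix_mult_def algebra_simps sum.distrib sum_distrib_left)

lemma integral_linear_image:
  fixes f :: "real \<Rightarrow> 'a::euclidean_space" and h :: "'a \<Rightarrow> 'b::real_normed_vector"
  assumes "f integrable_on S" "linear h"
  shows "(\<lambda>t. h (f t)) integrable_on S" "integral S (\<lambda>t. h (f t)) = h (integral S f)"
proof -
  have "bounded_linear h" using assms(2) by (simp add: linear_conv_bounded_linear)
  then show "(\<lambda>t. h (f t)) integrable_on S" "integral S (\<lambda>t. h (f t)) = h (integral S f)"
    using integrable_linear[OF assms(1)] integral_linear[OF assms(1)] by (force simp: o_def)+
qed

text \<open>
  The composition formula for \<open>\<psi> \<circ> \<phi>\<^sub>\<delta>\<^sub>-\<^sub>t\<close>, integrated in \<open>t\<close>. Two of the three terms are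
  linear in the pulled back tensor, with coefficients fixed at \<open>x\<close> and \<open>\<phi>\<^sub>\<delta>(x)\<close>, so that integration
  turns that tensor into \<open>\<Pi>\<^sub>\<delta>\<close>; the third is the integral that remains in the formula.
\<close>

lemma (in differentiable_flow) integral_second_fund_form_flow:
  fixes B :: "('m::{t2_space,second_countable_topology}, 'q::finite) chart set"
  assumes B: "smooth_atlas B" and \<psi>: "Ck_map 2 A B \<psi>" and \<Gamma>: "is_connection A \<Gamma>"
    and \<alpha>: "tensor_field A \<alpha>" "\<And>c. c \<in> A \<Longrightarrow> continuous_on (cdom c) (\<alpha> c)"
    and trace: "\<And>c. c \<in> A \<Longrightarrow> continuous_on (cdom c) (\<lambda>x. on_tensor (connector \<Gamma> c x) (\<alpha> c x))"
    and \<delta>: "0 \<le> \<delta>" and c: "c \<in> B" "\<psi> (\<phi> \<delta> x) \<in> cdom c"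
  defines "P \<equiv> Pi_tensor A \<alpha> \<phi> x"
  shows "integral {0..\<delta>} (\<lambda>t. second_fund_form A \<Gamma> \<Gamma>' (\<psi> \<circ> \<phi> (\<delta> - t)) (\<phi> t x) (\<lambda>c. \<alpha> c (\<phi> t x)) c) =
    second_fund_form A \<Gamma> \<Gamma>' \<psi> (\<phi> \<delta> x) (push2 A (\<phi> \<delta>) x (P \<delta>)) c
    + push A \<psi> (\<phi> \<delta> x) (\<lambda>c'. second_fund_form A \<Gamma> \<Gamma> (\<phi> \<delta>) x (P \<delta>) c'
        - integral {0..\<delta>} (\<lambda>t. push A (\<phi> (\<delta> - t)) (\<phi> t x)
            (second_fund_form A \<Gamma> \<Gamma> (\<phi> t) x (tensor_rate P t)) c')) c"
proof -
  define c0 where "c0 = chart_at A x"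
  define d where "d = chart_at A (\<phi> \<delta> x)"
  have c0: "c0 \<in> A" "x \<in> cdom c0" and d: "d \<in> A" "\<phi> \<delta> x \<in> cdom d"
    unfolding c0_def d_def using chart_at[OF atlas] by auto
  define M where "M = pulled_back \<alpha> x c0"
  have cM: "continuous_on {0..\<delta>} M"
    unfolding M_def by (rule continuous_on_subset[OF pulled_back_continuous[OF \<alpha> c0]]) auto
  then have iM: "M integrable_on {0..\<delta>}" by (rule integrable_continuous_interval)
  have PM: "P \<delta> c0 = integral {0..\<delta>} M" unfolding P_def Pi_tensor_def M_def ..
  define L where "L = flow_matrix c0 d \<delta> x"
  define S where "S t = second_fund_form A \<Gamma> \<Gamma> (\<phi> (\<delta> - t)) (\<phi> t x) (\<lambda>c. \<alpha> c (\<phi> t x)) d" for t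
  define K where "K t = push A (\<phi> (\<delta> - t)) (\<phi> t x) (second_fund_form A \<Gamma> \<Gamma> (\<phi> t) x (tensor_rate P t)) d" for t
  define D\<psi> where "D\<psi> = D1 (local_rep d c \<psi>) (cmap d (\<phi> \<delta> x))"
  have C\<psi>: "C2_at d c \<psi> (\<phi> \<delta> x)" by (rule C2_at_Ck_map[OF atlas d(1) B c(1) \<psi> d(2) c(2)])
  have lin: "linear D\<psi>" unfolding D\<psi>_def by (rule C2_at_linear[OF C\<psi>])
  have split: "\<phi> (\<delta> - t) (\<phi> t x) = \<phi> \<delta> x" if "t \<in> {0..\<delta>}" for t
    using flow_add[of t "\<delta> - t" x] that by simp
  have K: "K t = sff_chart \<Gamma> \<Gamma> c0 d (\<phi> \<delta>) x (M t) - S t" if "t \<in> {0..\<delta>}" for t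
    using second_fund_form_flow_split[OF \<Gamma> \<alpha> _ _ d, of t] that
    unfolding K_def S_def P_def M_def c0_def by simp
  have "continuous_on {0..\<delta>} (\<lambda>t. second_fund_form A \<Gamma> \<Gamma> (\<phi> (\<delta> - t)) (\<phi> t x) (\<lambda>c. \<alpha> c (\<phi> t x)) d)"
  proof (rule second_fund_form_continuous[OF atlas atlas d(1) \<Gamma> \<alpha> trace family])
    show "continuous_on {0..\<delta>} (\<lambda>t. \<phi> t x)" by (rule continuous_on_subset[OF flow_continuous]) auto
    show "continuous_on {0..\<delta>} (\<lambda>t. \<Gamma> d (\<phi> (\<delta> - t) (\<phi> t x)) k i j)" for k i j
      by (rule continuous_on_eq[OF continuous_on_const]) (simp add: split)
  qed (use d(2) split in \<open>auto intro!: continuous_intros\<close>)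
  then have iS: "S integrable_on {0..\<delta>}"
    unfolding S_def[abs_def] by (rule integrable_continuous_interval)
  note sff = integral_linear_image[OF iM sff_chart_linear[of \<Gamma> \<Gamma> c0 d "\<phi> \<delta>" x]]
  have "integral {0..\<delta>} K = integral {0..\<delta>} (\<lambda>t. sff_chart \<Gamma> \<Gamma> c0 d (\<phi> \<delta>) x (M t) - S t)"
    by (rule integral_cong) (rule K)
  also have "\<dots> = sff_chart \<Gamma> \<Gamma> c0 d (\<phi> \<delta>) x (P \<delta> c0) - integral {0..\<delta>} S"
    unfolding integral_diff[OF sff(1) iS] sff(2) PM ..
  finally have intS: "integral {0..\<delta>} S = sff_chart \<Gamma> \<Gamma> c0 d (\<phi> \<delta>) x (P \<delta> c0) - integral {0..\<delta>} K"
    by simp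
  have point: "second_fund_form A \<Gamma> \<Gamma>' (\<psi> \<circ> \<phi> (\<delta> - t)) (\<phi> t x) (\<lambda>c. \<alpha> c (\<phi> t x)) c =
      sff_chart \<Gamma> \<Gamma>' d c \<psi> (\<phi> \<delta> x) (L ** M t ** transpose L) + D\<psi> (S t)" if t: "t \<in> {0..\<delta>}" for t
  proof -
    define c1 where "c1 = chart_at A (\<phi> t x)"
    have c1: "c1 \<in> A" "\<phi> t x \<in> cdom c1" unfolding c1_def using chart_at[OF atlas] by auto
    let ?L0 = "flow_matrix c0 c1 t x" and ?L1 = "flow_matrix c1 d (\<delta> - t) (\<phi> t x)"
    have f: "C2_at c1 d (\<phi> (\<delta> - t)) (\<phi> t x)"
      by (rule C2_at_flow) (use t c1 d split in auto)
    have "L = ?L1 ** ?L0"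
      using flow_matrix_add[of t "\<delta> - t" c0 c1 d x] t c0 c1 d unfolding L_def by simp
    then have "L ** M t ** transpose L = ?L1 ** (?L0 ** M t ** transpose ?L0) ** transpose ?L1"
      by (simp add: matrix_transpose_mul matrix_mul_assoc)
    also have "\<dots> = ?L1 ** \<alpha> c1 (\<phi> t x) ** transpose ?L1"
      using push_pulled_back[OF \<alpha>(1) _ c0(1) c1(1) c0(2) c1(2)] t unfolding M_def by simp
    finally have "L ** M t ** transpose L = ?L1 ** \<alpha> c1 (\<phi> t x) ** transpose ?L1" .
    then show ?thesis
      using sff_chart_compose[OF f, of c \<psi> \<Gamma> \<Gamma>' "\<alpha> c1 (\<phi> t x)" \<Gamma>] C\<psi>
      unfolding split[OF t] by (simp add: second_fund_form_sff_chart c1_def[symmetric] S_def D\<psi>_def)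
  qed
  have lin\<psi>: "linear (\<lambda>T. sff_chart \<Gamma> \<Gamma>' d c \<psi> (\<phi> \<delta> x) (L ** T ** transpose L))"
    using linear_compose[OF linear_congruence_transform sff_chart_linear] by (simp add: o_def)
  note sff\<psi> = integral_linear_image[OF iM lin\<psi>] and D\<psi> = integral_linear_image[OF iS lin]
  have "integral {0..\<delta>} (\<lambda>t. second_fund_form A \<Gamma> \<Gamma>' (\<psi> \<circ> \<phi> (\<delta> - t)) (\<phi> t x) (\<lambda>c. \<alpha> c (\<phi> t x)) c) =
      integral {0..\<delta>} (\<lambda>t. sff_chart \<Gamma> \<Gamma>' d c \<psi> (\<phi> \<delta> x) (L ** M t ** transpose L) + D\<psi> (S t))"
    by (rule integral_cong) (rule point)
  also have "\<dots> = sff_chart \<Gamma> \<Gamma>' d c \<psi> (\<phi> \<delta> x) (L ** P \<delta> c0 ** transpose L)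
      + D\<psi> (sff_chart \<Gamma> \<Gamma> c0 d (\<phi> \<delta>) x (P \<delta> c0) - integral {0..\<delta>} K)"
    unfolding integral_add[OF sff\<psi>(1) D\<psi>(1)] sff\<psi>(2) D\<psi>(2) PM[symmetric] intS ..
  also have "D\<psi> (sff_chart \<Gamma> \<Gamma> c0 d (\<phi> \<delta>) x (P \<delta> c0) - integral {0..\<delta>} K) =
      push A \<psi> (\<phi> \<delta> x) (\<lambda>c'. second_fund_form A \<Gamma> \<Gamma> (\<phi> \<delta>) x (P \<delta>) c'
        - integral {0..\<delta>} (\<lambda>t. push A (\<phi> (\<delta> - t)) (\<phi> t x)
            (second_fund_form A \<Gamma> \<Gamma> (\<phi> t) x (tensor_rate P t)) c')) c"
  proof -
    have "D\<psi> (V d) = push A \<psi> (\<phi> \<delta> x) V c" for V by (simp add: push_def Let_def d_def D\<psi>_def)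
    from this[symmetric] show ?thesis
      unfolding K_def[abs_def] c0_def by (simp only: second_fund_form_sff_chart)
  qed
  also have "sff_chart \<Gamma> \<Gamma>' d c \<psi> (\<phi> \<delta> x) (L ** P \<delta> c0 ** transpose L) =
      second_fund_form A \<Gamma> \<Gamma>' \<psi> (\<phi> \<delta> x) (push2 A (\<phi> \<delta>) x (P \<delta>)) c"
    by (simp add: second_fund_form_sff_chart push2_def Let_def c0_def d_def L_def)
  finally show ?thesis .
qed

theorem theorem4p5:
  fixes A :: "('n::{t2_space,second_countable_topology}, 'p::finite) chart set"
    and B :: "('m::{t2_space,second_countable_topology}, 'q::finite) chart set"
    and b \<xi> :: "('n, 'p) vfield"
    and \<sigma> \<alpha> g :: "('n, 'p) mfield"
    and r :: nat
    and \<Gamma> :: "('n, 'p) symbols"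
    and h :: "('m, 'q) mfield"
    and \<Gamma>' :: "('m, 'q) symbols"
    and \<psi> :: "'n \<Rightarrow> 'm"
    and x0 :: 'n
    and \<gamma>1 \<delta>1 \<delta> :: real
    and u :: "real \<Rightarrow> real \<Rightarrow> 'n \<Rightarrow> 'm"
    and \<phi> :: "real \<Rightarrow> 'n \<Rightarrow> 'n"
    and P :: "real \<Rightarrow> ('n, 'p) tens2"
  assumes N: "smooth_atlas A" "connected (UNIV :: 'n set)"
    and X: "diffusion A b \<sigma> r"
    and alpha: "\<alpha> = diffusion_variance \<sigma>"
    and g: "generalized_inverse A \<alpha> g"
    and nabla0: "sub_riemannian_connection A \<alpha> g \<Gamma>"
    and xi: "\<xi> = xi_field b \<sigma> \<Gamma>" "Ck_field 2 A \<xi>"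
    and M: "smooth_atlas B" "riemannian_metric B h" "levi_civita B h \<Gamma>'"
    and psi: "Ck_map 2 A B \<psi>"
    and pos: "\<gamma>1 > 0" "\<delta>1 > 0"
    and u: "pde_solution A B \<Gamma> \<Gamma>' \<xi> \<alpha> \<psi> \<gamma>1 \<delta>1 u"
    and u_unique: "\<And>v. pde_solution A B \<Gamma> \<Gamma>' \<xi> \<alpha> \<psi> \<gamma>1 \<delta>1 v \<Longrightarrow>
          \<forall>\<gamma>\<in>{0..\<gamma>1}. \<forall>t\<in>{0..\<delta>1}. \<forall>x. v \<gamma> t x = u \<gamma> t x"
    and delta: "0 \<le> \<delta>" "\<delta> \<le> \<delta>1"
    and flow: "is_flow A \<xi> \<phi>"
    and Pi: "P = Pi_tensor A \<alpha> \<phi> x0"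
  shows "u 0 \<delta> x0 = \<psi> (\<phi> \<delta> x0) \<and>
    (\<forall>c\<in>B. \<psi> (\<phi> \<delta> x0) \<in> cdom c \<longrightarrow>
      ((\<lambda>\<gamma>. cmap c (u \<gamma> \<delta> x0)) has_vector_derivative
        (1/2) *\<^sub>R
          (second_fund_form A \<Gamma> \<Gamma>' \<psi> (\<phi> \<delta> x0) (push2 A (\<phi> \<delta>) x0 (P \<delta>)) c
           + push A \<psi> (\<phi> \<delta> x0)
               (\<lambda>c'. second_fund_form A \<Gamma> \<Gamma> (\<phi> \<delta>) x0 (P \<delta>) c'
                 - integral {0..\<delta>} (\<lambda>t. push A (\<phi> (\<delta> - t)) (\<phi> t x0)
                     (second_fund_form A \<Gamma> \<Gamma> (\<phi> t) x0 (tensor_rate P t)) c')) c))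
      (at 0 within {0..\<gamma>1}))"
proof (intro conjI ballI impI)
  interpret differentiable_flow A \<xi> \<phi> using N(1) xi(2) flow by unfold_locales
  have u0: "u 0 t x = \<psi> (\<phi> t x)" if "t \<in> {0..\<delta>}" for t x
    using unperturbed_solution[OF M(1) u pos(1) _ _ pos(2)] that delta by simp
  show "u 0 \<delta> x0 = \<psi> (\<phi> \<delta> x0)" using u0 delta by simp
  fix c assume c: "c \<in> B" "\<psi> (\<phi> \<delta> x0) \<in> cdom c"
  have \<Gamma>: "is_connection A \<Gamma>" using nabla0 unfolding sub_riemannian_connection_def by blast
  have \<alpha>: "tensor_field A \<alpha>" "\<And>c. c \<in> A \<Longrightarrow> continuous_on (cdom c) (\<alpha> c)"
    and trace: "\<And>c. c \<in> A \<Longrightarrow> continuous_on (cdom c) (\<lambda>x. on_tensor (connector \<Gamma> c x) (\<alpha> c x))"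
    using diffusion_variance_tensor_field[OF N(1) X] diffusion_variance_continuous[OF N(1)]
      trace_continuous[OF N(1)] X xi(2) unfolding alpha xi(1) diffusion_def by blast+
  let ?F = "\<lambda>(\<gamma>, t). u \<gamma> t"
  have fam: "Ck_family 2 ({0..\<gamma>1} \<times> {0..\<delta>1}) A B ?F" using u unfolding pde_solution_def by blast
  define w where "w q = ?F q (\<phi> (\<delta> - snd q) x0)" for q
  let ?R = "{0..\<gamma>1} \<times> {0..\<delta>}"
  have xR: "continuous_on ?R (\<lambda>q. \<phi> (\<delta> - snd q) x0)"
    by (rule continuous_on_compose2[OF flow_continuous]) (auto intro!: continuous_intros)
  have w: "continuous_on ?R w"
    unfolding w_def
    by (rule Ck_family_continuous[OF fam continuous_on_id xR]) (use delta in auto)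
  \<comment> \<open>the chart \<open>c\<close> is only good for small \<open>\<gamma>\<close>, uniformly in \<open>s\<close> since \<open>w (0, s)\<close> does not move\<close>
  have w0: "w (0, s) = \<psi> (\<phi> \<delta> x0)" if "s \<in> {0..\<delta>}" for s
    using u0[OF that] flow_add[of "\<delta> - s" s x0] that unfolding w_def by simp
  obtain W where W: "open W" "W \<inter> ?R = w -` cdom c \<inter> ?R"
    using w smooth_atlasD(1)[OF M(1) c(1)] unfolding continuous_on_open_invariant by blast
  have "{0} \<times> {0..\<delta>} \<subseteq> W" using W(2) w0 c(2) pos(1) by auto
  then obtain e where e: "e > 0" "(\<Union>q\<in>{0} \<times> {0..\<delta>}. ball q e) \<subseteq> W"
    using compact_subset_open_imp_ball_epsilon_subset[OF compact_Times[OF compact_sing compact_Icc] W(1)]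
    by metis
  define \<epsilon> where "\<epsilon> = min (e / 2) \<gamma>1"
  have \<epsilon>: "\<epsilon> > 0" "\<epsilon> \<le> \<gamma>1" "\<epsilon> < e" unfolding \<epsilon>_def using e(1) pos(1) by auto
  let ?Q = "{0..\<epsilon>} \<times> {0..\<delta>}"
  have QR: "?Q \<subseteq> ?R" using \<epsilon>(2) by auto
  have wQ: "w q \<in> cdom c" if q: "q \<in> ?Q" for q
  proof -
    have "q \<in> ball (0, snd q) e" using q \<epsilon>(3) by (cases q) (auto simp: dist_Pair_Pair)
    moreover have "(0, snd q) \<in> {0} \<times> {0..\<delta>}" using q by auto
    ultimately have "q \<in> W" using e(2) by blast
    then show ?thesis using W(2) q QR by blast
  qed
  define J where "J \<gamma> s = second_fund_form A \<Gamma> \<Gamma>' (u \<gamma> s) (\<phi> (\<delta> - s) x0) (\<lambda>c. \<alpha> c (\<phi> (\<delta> - s) x0)) c" for \<gamma> s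
  have "continuous_on ?Q (\<lambda>q. second_fund_form A \<Gamma> \<Gamma>' (?F q) (\<phi> (\<delta> - snd q) x0)
      (\<lambda>c. \<alpha> c (\<phi> (\<delta> - snd q) x0)) c)"
  proof (rule second_fund_form_continuous[OF N(1) M(1) c(1) \<Gamma> \<alpha> trace fam continuous_on_id])
    have "continuous_on ?Q (\<lambda>q. \<Gamma>' c (w q) k i j)" for k i j
      by (rule continuous_on_compose2[OF levi_civita_continuous[OF M(1) c(1) M(2,3)]
            continuous_on_subset[OF w QR]]) (use wQ in auto)
    then show "continuous_on ?Q (\<lambda>q. \<Gamma>' c (?F q (\<phi> (\<delta> - snd q) x0)) k i j)" for k i j
      unfolding w_def .
    show "?F q (\<phi> (\<delta> - snd q) x0) \<in> cdom c" if "q \<in> ?Q" for q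
      using wQ[OF that] unfolding w_def .
  qed (use \<epsilon>(2) delta continuous_on_subset[OF xR QR] in auto)
  then have J: "continuous_on ?Q (\<lambda>(\<gamma>, s). J \<gamma> s)"
    by (simp add: J_def case_prod_unfold)
  have deriv: "((\<lambda>\<gamma>. cmap c (u \<gamma> \<delta> (\<phi> (\<delta> - \<delta>) x0))) has_vector_derivative (1 / 2) *\<^sub>R integral {0..\<delta>} (J 0))
      (at 0 within {0..\<epsilon>})"
  proof (rule derivative_of_scaled_integral[where G = "\<lambda>\<gamma> s. cmap c (u \<gamma> s (\<phi> (\<delta> - s) x0))",
        OF \<epsilon>(1) delta(1) _ _ J])
    fix \<gamma> assume \<gamma>: "\<gamma> \<in> {0..\<epsilon>}"
    show "((\<lambda>s. cmap c (u \<gamma> s (\<phi> (\<delta> - s) x0))) has_vector_derivative (\<gamma> / 2) *\<^sub>R J \<gamma> s) (at s within {0..\<delta>})"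
      if "s \<in> {0..\<delta>}" for s
      unfolding J_def
      by (rule transport_derivative[OF M(1) u _ delta(2) pos(2) that c(1)])
        (use \<gamma> \<epsilon>(2) wQ[of "(\<gamma>, s)"] that in \<open>auto simp: w_def\<close>)
    show "cmap c (u \<gamma> 0 (\<phi> (\<delta> - 0) x0)) = cmap c (\<psi> (\<phi> \<delta> x0))"
      using u \<gamma> \<epsilon>(2) unfolding pde_solution_def by auto
  qed
  have at0: "at 0 within {0..\<epsilon>} = at 0 within {0..\<gamma>1}"
    by (rule at_within_nhd[of _ "{..<\<epsilon>}"]) (use \<epsilon> in auto)
  have int: "integral {0..\<delta>} (J 0) = integral {0..\<delta>}
      (\<lambda>t. second_fund_form A \<Gamma> \<Gamma>' (\<psi> \<circ> \<phi> (\<delta> - t)) (\<phi> t x0) (\<lambda>c. \<alpha> c (\<phi> t x0)) c)"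
  proof -
    have J0: "J 0 (\<delta> - t) = second_fund_form A \<Gamma> \<Gamma>' (\<psi> \<circ> \<phi> (\<delta> - t)) (\<phi> t x0) (\<lambda>c. \<alpha> c (\<phi> t x0)) c"
      if "t \<in> {0..\<delta>}" for t
    proof -
      have "u 0 (\<delta> - t) = \<psi> \<circ> \<phi> (\<delta> - t)" using u0[of "\<delta> - t"] that by (simp add: fun_eq_iff)
      then show ?thesis by (simp add: J_def)
    qed
    show ?thesis unfolding integral_reversed[of \<delta> "J 0", symmetric] by (rule integral_cong) (rule J0)
  qed
  show "((\<lambda>\<gamma>. cmap c (u \<gamma> \<delta> x0)) has_vector_derivative
        (1/2) *\<^sub>R
          (second_fund_form A \<Gamma> \<Gamma>' \<psi> (\<phi> \<delta> x0) (push2 A (\<phi> \<delta>) x0 (P \<delta>)) c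
           + push A \<psi> (\<phi> \<delta> x0)
               (\<lambda>c'. second_fund_form A \<Gamma> \<Gamma> (\<phi> \<delta>) x0 (P \<delta>) c'
                 - integral {0..\<delta>} (\<lambda>t. push A (\<phi> (\<delta> - t)) (\<phi> t x0)
                     (second_fund_form A \<Gamma> \<Gamma> (\<phi> t) x0 (tensor_rate P t)) c')) c))
      (at 0 within {0..\<gamma>1})" (is "(_ has_vector_derivative (1/2) *\<^sub>R ?D) _")
  proof -
    have "integral {0..\<delta>} (J 0) = ?D"
      unfolding int Pi by (rule integral_second_fund_form_flow[OF M(1) psi \<Gamma> \<alpha> trace delta(1) c])
    then show ?thesis using deriv unfolding at0 by (simp only: diff_self flow_0)
  qed
qed

end
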